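(* Let $p$ be a prime and let $G$ be a finite nonabelian $p$-group. Then $\upsilon_\infty=G$ if and only if $G$ is a nested GVZ-group. In this event, if $G=X_0>X_1>\dotsb>X_n>1$ is the chain of centers for $G$, then $\upsilon_i=[G,X_{n-i}]$ for each $0\le i\le n$, and $\upsilon_{n+1}=G$.
   Context: All groups are finite and characters are complex; $\mathrm{Irr}(G)$ is the set of irreducible characters of $G$, and $Z(G)$ is the center of $G$. For a normal subgroup $N\lhd G$, let $\mathrm{Irr}(G\mid N)=\{\chi\in\mathrm{Irr}(G): N\nleq\ker(\chi)\}$, and let $V(G\mid N)$ be the subgroup of $G$ generated by all $g\in G$ such that $\chi(g)\neq 0$ for some $\chi\in\mathrm{Irr}(G\mid N)$. For $N\lhd G$, let $U(G\mid N)=\prod H$, the product of all normal subgroups $H\lhd G$ satisfying $V(G\mid H)\le N$. Put $U(G)=U(G\mid Z(G))$. Define normal subgroups $1=\upsilon_0\le\upsilon_1\le\upsilon_2\le\dotsb$ of $G$ by $\upsilon_0=1$ and $\upsilon_{i+1}/\upsilon_i=U(G/\upsilon_i)$ for $i\ge 0$; $\upsilon_\infty$ denotes the terminal member (eventual constant value) of this ascending chain. For $\chi\in\mathrm{Irr}(G)$, $Z(\chi)=\{g\in G:|\chi(g)|=\chi(1)\}$ is the center of $\chi$, and $V(\chi)$ is the subgroup generated by all $g\in G$ with $\chi(g)\ne 0$. $G$ is a GVZ-group if $V(\chi)=Z(\chi)$ for all $\chi\in\mathrm{Irr}(G)$ (i.e. every $\chi\in\mathrm{Irr}(G)$ vanishes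 on $G\setminus Z(\chi)$). $G$ is nested if the set $\{Z(\chi):\chi\in\mathrm{Irr}(G)\}$ is a chain under inclusion; in that case this set, listed as $G=X_0>X_1>\dotsb>X_n$, is called the chain of centers for $G$. A nested GVZ-group is a group that is both nested and a GVZ-group. *)

theory Defs
  imports
    "HOL-Algebra.Generated_Groups"
    "HOL-Computational_Algebra.Primes"
    "Jordan_Normal_Form.VS_Connect"
begin

definition is_rep :: "('a, 'b) monoid_scheme \<Rightarrow> nat \<Rightarrow> ('a \<Rightarrow> complex mat) \<Rightarrow> bool" where
  "is_rep G n \<rho> \<longleftrightarrow> \<rho> \<in> hom G (units_of (ring_mat TYPE(complex) n ()))"

definition irreducible_rep :: "('a, 'b) monoid_scheme \<Rightarrow> nat \<Rightarrow> ('a \<Rightarrow> complex mat) \<Rightarrow> bool" where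
  "irreducible_rep G n \<rho> \<longleftrightarrow>
     is_rep G n \<rho> \<and> n > 0 \<and>
     (\<forall>W. subspace class_ring W (module_vec TYPE(complex) n) \<and>
          (\<forall>g\<in>carrier G. \<forall>w\<in>W. \<rho> g *\<^sub>v w \<in> W)
        \<longrightarrow> W = {0\<^sub>v n} \<or> W = carrier_vec n)"

definition rep_char :: "('a, 'b) monoid_scheme \<Rightarrow> nat \<Rightarrow> ('a \<Rightarrow> complex mat) \<Rightarrow> 'a \<Rightarrow> complex" where
  "rep_char G n \<rho> = (\<lambda>g\<in>carrier G. \<Sum>i<n. \<rho> g $$ (i, i))"

definition Irr :: "('a, 'b) monoid_scheme \<Rightarrow> ('a \<Rightarrow> complex) set" where
  "Irr G = {rep_char G n \<rho> | n \<rho>. irreducible_rep G n \<rho>}"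

definition char_ker :: "('a, 'b) monoid_scheme \<Rightarrow> ('a \<Rightarrow> complex) \<Rightarrow> 'a set" where
  "char_ker G \<chi> = {g \<in> carrier G. \<chi> g = \<chi> \<one>\<^bsub>G\<^esub>}"

definition char_center :: "('a, 'b) monoid_scheme \<Rightarrow> ('a \<Rightarrow> complex) \<Rightarrow> 'a set" where
  "char_center G \<chi> = {g \<in> carrier G. complex_of_real (cmod (\<chi> g)) = \<chi> \<one>\<^bsub>G\<^esub>}"

definition char_V :: "('a, 'b) monoid_scheme \<Rightarrow> ('a \<Rightarrow> complex) \<Rightarrow> 'a set" where
  "char_V G \<chi> = generate G {g \<in> carrier G. \<chi> g \<noteq> 0}"

definition Irr_rel :: "('a, 'b) monoid_scheme \<Rightarrow> 'a set \<Rightarrow> ('a \<Rightarrow> complex) set" where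
  "Irr_rel G N = {\<chi> \<in> Irr G. \<not> N \<subseteq> char_ker G \<chi>}"

definition V_rel :: "('a, 'b) monoid_scheme \<Rightarrow> 'a set \<Rightarrow> 'a set" where
  "V_rel G N = generate G {g \<in> carrier G. \<exists>\<chi>\<in>Irr_rel G N. \<chi> g \<noteq> 0}"

(* The product of a family of normal subgroups is the subgroup generated by its members. *)
definition U_rel :: "('a, 'b) monoid_scheme \<Rightarrow> 'a set \<Rightarrow> 'a set" where
  "U_rel G N = generate G (\<Union>{H. H \<lhd> G \<and> V_rel G H \<subseteq> N})"

definition group_center :: "('a, 'b) monoid_scheme \<Rightarrow> 'a set" where
  "group_center G = {z \<in> carrier G. \<forall>g\<in>carrier G. z \<otimes>\<^bsub>G\<^esub> g = g \<otimes>\<^bsub>G\<^esub> z}"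

definition U_group :: "('a, 'b) monoid_scheme \<Rightarrow> 'a set" where
  "U_group G = U_rel G (group_center G)"

(* The successor step takes the full preimage in G of the subgroup U_group of the quotient,
   whose elements are the right cosets of the preceding member. *)
primrec upsilon :: "('a, 'b) monoid_scheme \<Rightarrow> nat \<Rightarrow> 'a set" where
  "upsilon G 0 = {\<one>\<^bsub>G\<^esub>}"
| "upsilon G (Suc i) = {g \<in> carrier G. upsilon G i #>\<^bsub>G\<^esub> g \<in> U_group (G Mod upsilon G i)}"

definition upsilon_inf :: "('a, 'b) monoid_scheme \<Rightarrow> 'a set" where
  "upsilon_inf G = (THE H. \<exists>m. \<forall>i\<ge>m. upsilon G i = H)"

definition char_centers :: "('a, 'b) monoid_scheme \<Rightarrow> 'a set set" where
  "char_centers G = char_center G ` Irr G"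

definition GVZ_group :: "('a, 'b) monoid_scheme \<Rightarrow> bool" where
  "GVZ_group G \<longleftrightarrow> (\<forall>\<chi>\<in>Irr G. char_V G \<chi> = char_center G \<chi>)"

definition nested_group :: "('a, 'b) monoid_scheme \<Rightarrow> bool" where
  "nested_group G \<longleftrightarrow> chain\<^sub>\<subseteq> (char_centers G)"

definition chain_of_centers :: "('a, 'b) monoid_scheme \<Rightarrow> nat \<Rightarrow> (nat \<Rightarrow> 'a set) \<Rightarrow> bool" where
  "chain_of_centers G n X \<longleftrightarrow>
     X 0 = carrier G \<and> (\<forall>i<n. X (Suc i) \<subset> X i) \<and> X ` {..n} = char_centers G"

definition commutator_subgroup :: "('a, 'b) monoid_scheme \<Rightarrow> 'a set \<Rightarrow> 'a set \<Rightarrow> 'a set" where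
  "commutator_subgroup G A B = generate G
     {a \<otimes>\<^bsub>G\<^esub> b \<otimes>\<^bsub>G\<^esub> inv\<^bsub>G\<^esub> a \<otimes>\<^bsub>G\<^esub> inv\<^bsub>G\<^esub> b | a b. a \<in> A \<and> b \<in> B}"

end

theory Submission
  imports
    Defs
    "Jordan_Normal_Form.Schur_Decomposition"
    "HOL-Algebra.Multiplicative_Group"
begin

text \<open>
  For \<open>g\<close> in a finite group \<open>G\<close> let \<open>\<gamma>(g)\<close> be the set of all commutators \<open>[x, g]\<close>,
  and let \<open>[G, g]\<close> be the subgroup that it generates. Character theory enters only through the
  following translation into statements about these sets.

  \<^item> For normal \<open>H\<close>, all \<open>\<chi> \<in> Irr(G | H)\<close> vanish at \<open>g\<close> if and only if \<open>H \<subseteq> \<gamma>(g)\<close>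
    (\<open>Irr_rel_vanish_iff\<close>); the condition says that the coset \<open>H g\<close> lies in the conjugacy class
    of \<open>g\<close>.
  \<^item> \<open>g \<in> Z(\<chi>)\<close> if and only if \<open>\<gamma>(g) \<subseteq> ker \<chi>\<close> (\<open>Irr_center_iff\<close>).
  \<^item> A normal subgroup is the intersection of the kernels of irreducible characters that contain
    it (\<open>Irr_separates_from_normal\<close>).

  The first and the third rest on the completeness of the irreducible characters among the class
  functions (\<open>class_function_orthogonal_to_Irr_zero\<close>).

  Consequently \<open>G\<close> is a GVZ-group if and only if \<open>[G, g] \<subseteq> \<gamma>(g)\<close> for every \<open>g\<close>, and \<open>U(G | N)\<close> is
  the largest normal subgroup contained in \<open>\<gamma>(g)\<close> for all \<open>g \<notin> N\<close>. Pulled back along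
  \<open>G \<rightarrow> G / K\<close> with \<open>K = \<upsilon>\<^sub>i\<close>, the second fact says that \<open>\<upsilon>\<^bsub>i+1\<^esub> \<subseteq> K \<gamma>(g)\<close> whenever
  \<open>\<gamma>(g)\<close> is not contained in \<open>K\<close>, that is, whenever \<open>g\<close> is not central modulo \<open>K\<close>, and that
  \<open>\<upsilon>\<^bsub>i+1\<^esub>\<close> contains every normal subgroup that lies in all these \<open>\<gamma>(g)\<close>.

  If some \<open>\<upsilon>\<^sub>m\<close> is \<open>G\<close>, take for a given \<open>g\<close> the least \<open>i\<close> with \<open>\<gamma>(g) \<subseteq> \<upsilon>\<^sub>i\<close>. Climbing the series
  from \<open>1\<close>, each \<open>\<upsilon>\<^sub>j\<close> with \<open>j \<le> i\<close> is swallowed by \<open>\<gamma>(g)\<close>, because a normal subgroup contained in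
  \<open>\<gamma>(g)\<close> can be multiplied into \<open>\<gamma>(g)\<close> without leaving it (\<open>absorb_commutators\<close>). So
  \<open>\<gamma>(g) = \<upsilon>\<^sub>i\<close> is a subgroup, which is the GVZ property, and these subgroups form a chain, which
  makes \<open>G\<close> nested.

  Conversely let \<open>G\<close> be a nested GVZ-group with chain of centers \<open>X\<^sub>0 > \<dots> > X\<^sub>n\<close>. An element \<open>g\<close> lies
  in \<open>X\<^sub>i\<close> exactly if it is central modulo \<open>[G, X\<^sub>i]\<close>, and \<open>[G, X\<^sub>j] \<subseteq> [G, g] = \<gamma>(g)\<close> for every \<open>g\<close>
  outside \<open>X\<^bsub>j+1\<^esub>\<close>. So if \<open>\<upsilon>\<^sub>i = [G, X\<^bsub>j+1\<^esub>]\<close>, then \<open>\<upsilon>\<^bsub>i+1\<^esub>\<close> contains \<open>[G, X\<^sub>j]\<close>, and an element of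
  \<open>X\<^sub>j - X\<^bsub>j+1\<^esub>\<close> shows that it is no larger. The series thus runs through the subgroups
  \<open>[G, X\<^bsub>n-i\<^esub>]\<close> and reaches \<open>G\<close> one step after \<open>[G, G]\<close>.
\<close>

section \<open>Complex matrices\<close>

lemma times_mat_entry:
  fixes A :: "'a::semiring_0 mat"
  assumes "A \<in> carrier_mat l m" "B \<in> carrier_mat m n" "i < l" "j < n"
  shows "(A * B) $$ (i, j) = (\<Sum>k<m. A $$ (i, k) * B $$ (k, j))"
  using assms by (auto simp: scalar_prod_def atLeast0LessThan intro!: sum.cong)

lemma mult_mat_vec_entry:
  fixes A :: "'a::semiring_0 mat"
  assumes "A \<in> carrier_mat m n" "v \<in> carrier_vec n" "i < m"
  shows "(A *\<^sub>v v) $ i = (\<Sum>k<n. A $$ (i, k) * v $ k)"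
  using assms by (auto simp: scalar_prod_def atLeast0LessThan intro!: sum.cong)

lemma trace_mult_commute:
  fixes A :: "'a::comm_semiring_0 mat"
  assumes A: "A \<in> carrier_mat m n" and B: "B \<in> carrier_mat n m"
  shows "(\<Sum>i<m. (A * B) $$ (i, i)) = (\<Sum>i<n. (B * A) $$ (i, i))"
proof -
  have "(\<Sum>i<m. (A * B) $$ (i, i)) = (\<Sum>i<m. \<Sum>k<n. A $$ (i, k) * B $$ (k, i))"
    by (intro sum.cong refl times_mat_entry[OF A B]) auto
  also have "\<dots> = (\<Sum>k<n. \<Sum>i<m. A $$ (i, k) * B $$ (k, i))"
    by (rule sum.swap)
  also have "\<dots> = (\<Sum>k<n. (B * A) $$ (k, k))"
    using times_mat_entry[OF B A] by (intro sum.cong refl) (auto simp: mult.commute)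
  finally show ?thesis .
qed

lemma trace_similar:
  fixes A :: "'a::comm_ring_1 mat"
  assumes A: "A \<in> carrier_mat n n" and P: "P \<in> carrier_mat n n" and Q: "Q \<in> carrier_mat n n"
    and QP: "Q * P = 1\<^sub>m n"
  shows "(\<Sum>i<n. (P * A * Q) $$ (i, i)) = (\<Sum>i<n. A $$ (i, i))"
proof -
  have "(\<Sum>i<n. (P * A * Q) $$ (i, i)) = (\<Sum>i<n. (Q * (P * A)) $$ (i, i))"
    using A P Q by (intro trace_mult_commute) auto
  also have "Q * (P * A) = (Q * P) * A"
    using A P Q by (intro assoc_mult_mat[symmetric]) auto
  also have "\<dots> = A" using A by (simp add: QP)
  finally show ?thesis .
qed

lemma upper_triangular_times:
  fixes A B :: "'a::semiring_0 mat"
  assumes A: "A \<in> carrier_mat n n" and B: "B \<in> carrier_mat n n"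
    and uA: "upper_triangular A" and uB: "upper_triangular B"
  shows "upper_triangular (A * B)"
    and "i < n \<Longrightarrow> (A * B) $$ (i, i) = A $$ (i, i) * B $$ (i, i)"
proof -
  have z: "A $$ (i, k) * B $$ (k, j) = 0" if "i < n" "k < n" "j < n" "k < i \<or> j < k" for i j k
    using that A B upper_triangularD[OF uA, of k i] upper_triangularD[OF uB, of j k] by auto
  show "upper_triangular (A * B)"
  proof (rule upper_triangularI)
    fix i j assume ij: "j < i" "i < dim_row (A * B)"
    hence "(A * B) $$ (i, j) = (\<Sum>k<n. A $$ (i, k) * B $$ (k, j))"
      using A by (intro times_mat_entry[OF A B]) auto
    also have "\<dots> = 0" using ij A by (intro sum.neutral ballI z) auto
    finally show "(A * B) $$ (i, j) = 0" .
  qed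
  assume i: "i < n"
  have "(A * B) $$ (i, i) = (\<Sum>k<n. A $$ (i, k) * B $$ (k, i))"
    using i by (intro times_mat_entry[OF A B])
  also have "\<dots> = (\<Sum>k\<in>{i}. A $$ (i, k) * B $$ (k, i))"
    using i by (intro sum.mono_neutral_right ballI z) auto
  finally show "(A * B) $$ (i, i) = A $$ (i, i) * B $$ (i, i)" by simp
qed

lemma upper_triangular_pow:
  fixes A :: "'a::comm_semiring_1 mat"
  assumes A: "A \<in> carrier_mat n n" and uA: "upper_triangular A"
  shows "upper_triangular (A ^\<^sub>m k) \<and> (\<forall>i<n. (A ^\<^sub>m k) $$ (i, i) = A $$ (i, i) ^ k)"
proof (induction k)
  case 0
  then show ?case using A by auto
next
  case (Suc k)
  have Ak: "A ^\<^sub>m k \<in> carrier_mat n n" using A by (rule pow_carrier_mat)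
  show ?case
    using upper_triangular_times[OF Ak A _ uA] Suc by (auto simp: mult.commute)
qed

text \<open>Equality in the triangle inequality: projecting onto the direction \<open>u\<close> of the sum, every
  summand contributes at most \<open>1\<close>, so all contribute exactly \<open>1\<close> and hence equal \<open>u\<close>.\<close>

lemma unit_complex_sum_extremal:
  fixes z :: "nat \<Rightarrow> complex"
  assumes n: "n > 0" and z: "\<And>i. i < n \<Longrightarrow> cmod (z i) = 1" and s: "cmod (\<Sum>i<n. z i) = real n"
  shows "\<exists>u. cmod u = 1 \<and> (\<forall>i<n. z i = u)"
proof -
  define u where "u = (\<Sum>i<n. z i) / of_nat n"
  have u1: "cmod u = 1" using s n by (simp add: u_def norm_divide)
  have uu: "u * cnj u = 1" using u1 by (simp add: complex_norm_square[symmetric])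
  have le: "Re (z i * cnj u) \<le> 1" if "i < n" for i
    using complex_Re_le_cmod[of "z i * cnj u"] z[OF that] u1 by (simp add: norm_mult)
  have "(\<Sum>i<n. z i * cnj u) = (\<Sum>i<n. z i) * cnj u" by (rule sum_distrib_right[symmetric])
  also have "(\<Sum>i<n. z i) = of_nat n * u" using n by (simp add: u_def)
  also have "of_nat n * u * cnj u = of_nat n" using uu by (simp add: mult.assoc)
  finally have "Re (\<Sum>i<n. z i * cnj u) = real n" by simp
  hence "(\<Sum>i<n. 1 - Re (z i * cnj u)) = 0" by (simp add: sum_subtractf)
  hence eq: "\<forall>i<n. Re (z i * cnj u) = 1"
    using le by (subst (asm) sum_nonneg_eq_0_iff) auto
  have "z i = u" if i: "i < n" for i
  proof -
    have "cmod (z i * cnj u) = 1" using z[OF i] u1 by (simp add: norm_mult)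
    hence "(Re (z i * cnj u))\<^sup>2 + (Im (z i * cnj u))\<^sup>2 = 1" by (simp add: cmod_def)
    hence "Im (z i * cnj u) = 0" using eq i by (simp del: times_complex.sel)
    hence one: "z i * cnj u = 1" using eq i by (simp add: complex_eq_iff del: times_complex.sel)
    have "z i = z i * (u * cnj u)" by (simp add: uu)
    also have "\<dots> = (z i * cnj u) * u" by (simp add: ac_simps)
    finally show ?thesis by (simp add: one)
  qed
  with u1 show ?thesis by blast
qed

text \<open>This is what makes \<open>|\<chi>(g)| = \<chi>(1)\<close> detect scalars. In triangular form the diagonal entries
  are roots of unity whose sum has the largest possible modulus, so they all equal some \<open>c\<close>; what
  remains is that a matrix of finite order with only one eigenvalue is scalar.\<close>

lemma finite_order_extremal_trace_scalar:
  fixes A :: "complex mat"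
  assumes A: "A \<in> carrier_mat n n" and n: "n > 0" and k: "k > 0"
    and pow: "A ^\<^sub>m k = 1\<^sub>m n" and tr: "cmod (\<Sum>i<n. A $$ (i, i)) = real n"
  shows "\<exists>c. A = c \<cdot>\<^sub>m 1\<^sub>m n"
proof -
  obtain as where "char_poly A = (\<Prod>a\<leftarrow>as. [:- a, 1:])"
    using char_poly_factorized[OF A] by blast
  then obtain B where B: "B \<in> carrier_mat n n" and uB: "upper_triangular B" and "similar_mat A B"
    using schur_decomposition_exists[OF A] by blast
  then obtain P Q where wit: "similar_mat_wit A B P Q" unfolding similar_mat_def by blast
  note w = similar_mat_witD2[OF A wit]
  have P: "P \<in> carrier_mat n n" and Q: "Q \<in> carrier_mat n n"
    and PQ: "P * Q = 1\<^sub>m n" and QP: "Q * P = 1\<^sub>m n" and APQ: "A = P * B * Q" using w by auto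
  have Bt: "B ^\<^sub>m t \<in> carrier_mat n n" for t using B by (rule pow_carrier_mat)
  have "similar_mat_wit (A ^\<^sub>m k) (B ^\<^sub>m k) P Q" by (rule similar_mat_wit_pow[OF wit])
  from similar_mat_wit_sym[OF this] have "B ^\<^sub>m k = Q * 1\<^sub>m n * P"
    unfolding similar_mat_wit_def pow by (auto simp: Let_def)
  hence Bk: "B ^\<^sub>m k = 1\<^sub>m n" using Q QP by simp
  note up = upper_triangular_pow[OF B uB]
  have "cmod (B $$ (i, i)) = 1" if i: "i < n" for i
  proof -
    have "B $$ (i, i) ^ k = 1" using up[of k] i Bk by simp
    hence "cmod (B $$ (i, i)) ^ k = 1" by (metis norm_one norm_power)
    thus ?thesis using k power_eq_imp_eq_base[of "cmod (B $$ (i, i))" k 1] by simp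
  qed
  moreover have "cmod (\<Sum>i<n. B $$ (i, i)) = real n"
    using tr trace_similar[OF B P Q QP] APQ by simp
  ultimately obtain c where c1: "cmod c = 1" and c: "\<And>i. i < n \<Longrightarrow> B $$ (i, i) = c"
    using unit_complex_sum_extremal[OF n, of "\<lambda>i. B $$ (i, i)"] by auto
  have c0: "c \<noteq> 0" using c1 by auto
  have ck: "c ^ k = 1" using up[of k] Bk n c[of 0] by (metis index_one_mat(1))
  \<comment> \<open>The sum \<open>E\<close> of the powers of \<open>B / c\<close> is absorbed by \<open>B / c\<close>, since \<open>(B / c)\<^sup>k = 1\<close>; it is\<close>
  \<comment> \<open>triangular with diagonal entries \<open>k\<close>, hence invertible, and this forces \<open>B = c\<close>.\<close>
  define E where "E = mat n n (\<lambda>(i, j). \<Sum>t<k. inverse c ^ t * (B ^\<^sub>m t) $$ (i, j))"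
  have E: "E \<in> carrier_mat n n" by (simp add: E_def)
  have uE: "upper_triangular E"
  proof (rule upper_triangularI)
    fix i j assume "j < i" "i < dim_row E"
    moreover from this have "(B ^\<^sub>m t) $$ (i, j) = 0" for t
      using up[of t] Bt[of t] E by (auto elim!: upper_triangularD)
    ultimately show "E $$ (i, j) = 0" using E by (simp add: E_def)
  qed
  have dE: "E $$ (i, i) = of_nat k" if "i < n" for i
  proof -
    have "inverse c ^ t * (B ^\<^sub>m t) $$ (i, i) = 1" for t
      using up[of t] c[OF that] that c0 by (simp add: power_inverse)
    thus ?thesis using that by (simp add: E_def)
  qed
  have "det E \<noteq> 0"
    using upper_triangular_imp_det_eq_0_iff[OF E uE] dE E k by (auto simp: diag_mat_def)
  then obtain F where F: "F \<in> carrier_mat n n" and FE: "F * E = 1\<^sub>m n"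
    using det_non_zero_imp_unit[OF E, of "()"] by (auto simp: Units_def ring_mat_def)
  have EB: "E * B = c \<cdot>\<^sub>m E"
  proof (rule eq_matI)
    fix i j assume "i < dim_row (c \<cdot>\<^sub>m E)" "j < dim_col (c \<cdot>\<^sub>m E)"
    hence i: "i < n" and j: "j < n" using E by auto
    define f where "f t = inverse c ^ t * (B ^\<^sub>m t) $$ (i, j)" for t
    have "(E * B) $$ (i, j) = (\<Sum>l<n. E $$ (i, l) * B $$ (l, j))"
      by (rule times_mat_entry[OF E B i j])
    also have "\<dots> = (\<Sum>l<n. \<Sum>t<k. inverse c ^ t * ((B ^\<^sub>m t) $$ (i, l) * B $$ (l, j)))"
      using i by (intro sum.cong refl) (simp add: E_def sum_distrib_right mult.assoc)
    also have "\<dots> = (\<Sum>t<k. inverse c ^ t * (\<Sum>l<n. (B ^\<^sub>m t) $$ (i, l) * B $$ (l, j)))"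
      by (subst sum.swap) (simp add: sum_distrib_left)
    also have "\<dots> = (\<Sum>t<k. inverse c ^ t * (B ^\<^sub>m Suc t) $$ (i, j))"
      using times_mat_entry[OF Bt B i j] by simp
    also have "\<dots> = (\<Sum>t<k. c * f (Suc t))"
      using c0 by (intro sum.cong refl) (simp add: f_def)
    also have "\<dots> = c * (\<Sum>t<k. f (Suc t))" by (simp add: sum_distrib_left)
    also have "(\<Sum>t<k. f (Suc t)) = (\<Sum>t<k. f t)"
    proof -
      have "f k = f 0" using Bk B ck by (simp add: f_def power_inverse)
      moreover have "f 0 + (\<Sum>t<k. f (Suc t)) = (\<Sum>t<k. f t) + f k"
        using sum.lessThan_Suc_shift[of f k] by simp
      ultimately show ?thesis by simp
    qed
    finally show "(E * B) $$ (i, j) = (c \<cdot>\<^sub>m E) $$ (i, j)" using i j E by (simp add: f_def E_def)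
  qed (use E B in auto)
  have "B = F * (E * B)" using assoc_mult_mat[OF F E B] FE B by simp
  also have "\<dots> = c \<cdot>\<^sub>m 1\<^sub>m n" unfolding EB using mult_smult_distrib[OF F E] FE by simp
  finally have "A = P * (c \<cdot>\<^sub>m 1\<^sub>m n) * Q" using APQ by simp
  also have "\<dots> = c \<cdot>\<^sub>m 1\<^sub>m n"
    using P Q PQ by (simp add: mult_smult_distrib[OF P one_carrier_mat] mult_smult_assoc_mat[OF P Q])
  finally show ?thesis by blast
qed

text \<open>A basis of the whole space (the columns of \<open>P\<close>) that extends a basis of \<open>W\<close> (the columns with
  index in \<open>J\<close>), in matrix form: \<open>Q\<close> computes coordinates, and vectors of \<open>W\<close> have coordinates
  supported on \<open>J\<close>. Take \<open>P\<close> with as many columns in \<open>W\<close> as possible; a vector of \<open>W\<close> with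
  a nonzero coordinate outside \<open>J\<close> could be exchanged for one more column.\<close>

lemma subspace_adapted_basis:
  fixes W :: "'a::field vec set"
  assumes W: "VectorSpace.subspace class_ring W (module_vec TYPE('a) n)"
  obtains P Q J where "P \<in> carrier_mat n n" "Q \<in> carrier_mat n n" "P * Q = 1\<^sub>m n" "Q * P = 1\<^sub>m n"
    "J \<subseteq> {..<n}" "\<And>j. j \<in> J \<Longrightarrow> col P j \<in> W"
    "\<And>w i. w \<in> W \<Longrightarrow> i < n \<Longrightarrow> i \<notin> J \<Longrightarrow> (Q *\<^sub>v w) $ i = 0"
proof -
  have sub: "W \<subseteq> carrier_vec n"
    using W unfolding VectorSpace.subspace_def submodule_def by (simp add: module_vec_simps)
  define good where "good J \<longleftrightarrow> J \<subseteq> {..<n} \<and>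
    (\<exists>P\<in>carrier_mat n n. det P \<noteq> 0 \<and> (\<forall>j\<in>J. col P j \<in> W))" for J
  have "good {}" unfolding good_def by (auto intro!: bexI[of _ "1\<^sub>m n"])
  moreover have "card J < Suc n" if "good J" for J
    using that card_mono[of "{..<n}" J] by (auto simp: good_def)
  ultimately obtain J where J: "good J" and max: "\<And>J'. good J' \<Longrightarrow> card J' \<le> card J"
    using ex_has_greatest_nat[of good "{}" card "Suc n"] by blast
  obtain P where P: "P \<in> carrier_mat n n" and dP: "det P \<noteq> 0" and PJ: "\<And>j. j \<in> J \<Longrightarrow> col P j \<in> W"
    and Jn: "J \<subseteq> {..<n}"
    using J unfolding good_def by blast
  obtain Q where Q: "Q \<in> carrier_mat n n" and PQ: "P * Q = 1\<^sub>m n" and QP: "Q * P = 1\<^sub>m n"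
    using det_non_zero_imp_unit[OF P dP, of "()"] by (auto simp: Units_def ring_mat_def)
  have "(Q *\<^sub>v w) $ i = 0" if w: "w \<in> W" and i: "i < n" "i \<notin> J" for w i
  proof (rule ccontr)
    assume nz: "(Q *\<^sub>v w) $ i \<noteq> 0"
    have wc: "w \<in> carrier_vec n" using w sub by blast
    have Pw: "P *\<^sub>v (Q *\<^sub>v w) = w"
      using wc P Q PQ by (simp add: assoc_mult_mat_vec[symmetric])
    \<comment> \<open>By Cramer's rule the exchange multiplies the determinant by the coordinate \<open>(Q w)\<^sub>i\<close>.\<close>
    let ?P = "replace_col P w i"
    have P': "?P \<in> carrier_mat n n" using P by (simp add: replace_col_def)
    have "det ?P = (Q *\<^sub>v w) $ i * det P"
      using cramer_lemma_mat[OF P _ i(1), of "Q *\<^sub>v w"] Q wc Pw by simp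
    hence "det ?P \<noteq> 0" using nz dP by simp
    moreover have "col ?P j \<in> W" if j: "j \<in> insert i J" for j
    proof (cases "j = i")
      case True
      hence "col ?P j = w" using wc P i by (intro eq_vecI) (auto simp: replace_col_def)
      thus ?thesis using w by simp
    next
      case False
      hence "j \<in> J" using j by simp
      moreover have "col ?P j = col P j"
        using \<open>j \<in> J\<close> Jn False P by (intro eq_vecI) (auto simp: replace_col_def)
      ultimately show ?thesis using PJ by simp
    qed
    ultimately have "good (insert i J)"
      using i Jn P' unfolding good_def by blast
    from max[OF this] show False
      using i finite_subset[OF Jn] by simp
  qed
  thus ?thesis using that[OF P Q PQ QP Jn PJ] by blast
qed

lemma subspace_mult_mat_vec:
  fixes W :: "'a::field vec set"
  assumes W: "VectorSpace.subspace class_ring W (module_vec TYPE('a) n)" and P: "P \<in> carrier_mat n n"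
    and PW: "\<And>j. j < n \<Longrightarrow> col P j \<in> W" and v: "v \<in> carrier_vec n"
  shows "P *\<^sub>v v \<in> W"
proof -
  have add: "\<And>x y. x \<in> W \<Longrightarrow> y \<in> W \<Longrightarrow> x + y \<in> W" and zero: "0\<^sub>v n \<in> W"
    and smult: "\<And>c x. x \<in> W \<Longrightarrow> c \<cdot>\<^sub>v x \<in> W"
    using W unfolding VectorSpace.subspace_def submodule_def by (auto simp: module_vec_simps)
  define part where "part m = vec n (\<lambda>i. \<Sum>k<m. P $$ (i, k) * v $ k)" for m
  have "part m \<in> W" if "m \<le> n" for m using that
  proof (induction m)
    case 0
    have "part 0 = 0\<^sub>v n" by (intro eq_vecI) (auto simp: part_def)
    thus ?case using zero by simp
  next
    case (Suc m)
    have "part (Suc m) = part m + v $ m \<cdot>\<^sub>v col P m"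
      using P Suc.prems by (intro eq_vecI) (auto simp: part_def mult.commute)
    thus ?case using Suc add smult PW by simp
  qed
  moreover have "P *\<^sub>v v = part n"
    using mult_mat_vec_entry[OF P v] P by (intro eq_vecI) (auto simp: part_def)
  ultimately show ?thesis by simp
qed

section \<open>Representations and their composition factors\<close>

lemma is_rep_carrier: "is_rep G n \<rho> \<Longrightarrow> g \<in> carrier G \<Longrightarrow> \<rho> g \<in> carrier_mat n n"
  unfolding is_rep_def by (auto simp: hom_def units_of_def Units_def ring_mat_def)

lemma is_rep_mult:
  "is_rep G n \<rho> \<Longrightarrow> g \<in> carrier G \<Longrightarrow> h \<in> carrier G \<Longrightarrow> \<rho> (g \<otimes>\<^bsub>G\<^esub> h) = \<rho> g * \<rho> h"
  unfolding is_rep_def by (auto simp: hom_def units_of_def ring_mat_def)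

lemma is_rep_one:
  assumes "group G" "is_rep G n \<rho>"
  shows "\<rho> \<one>\<^bsub>G\<^esub> = 1\<^sub>m n"
proof -
  interpret G: group G by fact
  interpret R: ring "ring_mat TYPE(complex) n ()" by (rule ring_mat)
  have "group_hom G (units_of (ring_mat TYPE(complex) n ())) \<rho>"
    using assms R.units_group unfolding is_rep_def group_hom_def group_hom_axioms_def by simp
  from group_hom.hom_one[OF this] show ?thesis
    by (simp add: units_of_def ring_mat_def)
qed

lemma is_repI:
  fixes G :: "('a, 'b) monoid_scheme" (structure)
  assumes "group G" and c: "\<And>g. g \<in> carrier G \<Longrightarrow> \<rho> g \<in> carrier_mat n n"
    and one: "\<rho> \<one>\<^bsub>G\<^esub> = 1\<^sub>m n"
    and mult: "\<And>g h. g \<in> carrier G \<Longrightarrow> h \<in> carrier G \<Longrightarrow> \<rho> (g \<otimes>\<^bsub>G\<^esub> h) = \<rho> g * \<rho> h"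
  shows "is_rep G n \<rho>"
proof -
  interpret group G by fact
  have "\<rho> g * \<rho> (inv g) = 1\<^sub>m n" "\<rho> (inv g) * \<rho> g = 1\<^sub>m n" if "g \<in> carrier G" for g
    using mult[of g "inv g"] mult[of "inv g" g] that one by auto
  thus ?thesis
    using c mult unfolding is_rep_def
    by (auto simp: hom_def units_of_def Units_def ring_mat_def intro!: bexI[of _ "\<rho> (inv _)"])
qed

lemma is_rep_entry_mult:
  assumes "is_rep G n \<rho>" "g \<in> carrier G" "h \<in> carrier G" "i < n" "j < n"
  shows "\<rho> (g \<otimes>\<^bsub>G\<^esub> h) $$ (i, j) = (\<Sum>k<n. \<rho> g $$ (i, k) * \<rho> h $$ (k, j))"
  unfolding is_rep_mult[OF assms(1-3)]
  by (rule times_mat_entry[OF is_rep_carrier[OF assms(1,2)] is_rep_carrier[OF assms(1,3)] assms(4,5)])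

text \<open>The diagonal block with index set \<open>S\<close> of a block triangular representation is a
  representation. The two alternatives cover the two diagonal blocks: \<open>S\<close> spans an invariant
  subspace, or its complement does.\<close>

lemma is_rep_compress:
  fixes G :: "('a, 'b) monoid_scheme" (structure)
  assumes G: "group G" and rep: "is_rep G n \<rho>" and S: "S \<subseteq> {..<n}"
    and z: "(\<forall>g\<in>carrier G. \<forall>i<n. \<forall>j<n. i \<notin> S \<longrightarrow> j \<in> S \<longrightarrow> \<rho> g $$ (i, j) = 0) \<or>
            (\<forall>g\<in>carrier G. \<forall>i<n. \<forall>j<n. i \<in> S \<longrightarrow> j \<notin> S \<longrightarrow> \<rho> g $$ (i, j) = 0)"
  shows "\<exists>\<sigma>. is_rep G (card S) \<sigma> \<and>
    (\<forall>g\<in>carrier G. (\<Sum>i<card S. \<sigma> g $$ (i, i)) = (\<Sum>i\<in>S. \<rho> g $$ (i, i)))"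
proof -
  interpret group G by fact
  have fin: "finite S" using S finite_subset by blast
  obtain e where e: "bij_betw e {..<card S} S"
    using ex_bij_betw_nat_finite[OF fin] by (auto simp: atLeast0LessThan)
  have eS: "e i \<in> S" if "i < card S" for i using that bij_betwE[OF e] by simp
  have en: "e i < n" if "i < card S" for i using eS[OF that] S by auto
  have inj: "e i = e j \<longleftrightarrow> i = j" if "i < card S" "j < card S" for i j
    using that bij_betw_imp_inj_on[OF e] by (auto dest: inj_onD)
  define \<sigma> where "\<sigma> g = mat (card S) (card S) (\<lambda>(i, j). \<rho> g $$ (e i, e j))" for g
  have "is_rep G (card S) \<sigma>"
  proof (rule is_repI[OF G])
    fix g h assume g: "g \<in> carrier G" and h: "h \<in> carrier G"
    show "\<sigma> (g \<otimes> h) = \<sigma> g * \<sigma> h"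
    proof (rule eq_matI)
      fix i j assume "i < dim_row (\<sigma> g * \<sigma> h)" "j < dim_col (\<sigma> g * \<sigma> h)"
      hence i: "i < card S" and j: "j < card S" by (auto simp: \<sigma>_def)
      have "\<sigma> (g \<otimes> h) $$ (i, j) = (\<Sum>k<n. \<rho> g $$ (e i, k) * \<rho> h $$ (k, e j))"
        using i j by (simp add: \<sigma>_def is_rep_entry_mult[OF rep g h en en])
      also have "\<dots> = (\<Sum>k\<in>S. \<rho> g $$ (e i, k) * \<rho> h $$ (k, e j))"
        using S z g h en[OF i] en[OF j] eS[OF i] eS[OF j]
        by (intro sum.mono_neutral_right) auto
      also have "\<dots> = (\<Sum>k<card S. \<rho> g $$ (e i, e k) * \<rho> h $$ (e k, e j))"
        by (rule sum.reindex_bij_betw[OF e, symmetric])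
      also have "\<dots> = (\<Sum>k<card S. \<sigma> g $$ (i, k) * \<sigma> h $$ (k, j))"
        using i j by (simp add: \<sigma>_def)
      also have "\<dots> = (\<sigma> g * \<sigma> h) $$ (i, j)"
        using i j by (intro times_mat_entry[symmetric]) (auto simp: \<sigma>_def)
      finally show "\<sigma> (g \<otimes> h) $$ (i, j) = (\<sigma> g * \<sigma> h) $$ (i, j)" .
    qed (auto simp: \<sigma>_def)
  next
    show "\<sigma> \<one> = 1\<^sub>m (card S)"
      using is_rep_one[OF G rep] en inj by (intro eq_matI) (auto simp: \<sigma>_def)
  qed (auto simp: \<sigma>_def)
  moreover have "(\<Sum>i<card S. \<sigma> g $$ (i, i)) = (\<Sum>i\<in>S. \<rho> g $$ (i, i))" for g
    using sum.reindex_bij_betw[OF e, of "\<lambda>i. \<rho> g $$ (i, i)"] by (simp add: \<sigma>_def)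
  ultimately show ?thesis by blast
qed

text \<open>In a basis adapted to an invariant subspace all matrices are block triangular. The trace only
  sees the diagonal blocks, so no invariant complement is needed.\<close>

lemma reducible_rep_char_splits:
  fixes G :: "('a, 'b) monoid_scheme" (structure)
  assumes G: "group G" and rep: "is_rep G n \<rho>" and W: "VectorSpace.subspace class_ring W (module_vec TYPE(complex) n)"
    and inv: "\<And>g w. g \<in> carrier G \<Longrightarrow> w \<in> W \<Longrightarrow> \<rho> g *\<^sub>v w \<in> W"
    and W0: "W \<noteq> {0\<^sub>v n}" and W1: "W \<noteq> carrier_vec n"
  shows "\<exists>k l \<sigma> \<tau>. k < n \<and> l < n \<and> is_rep G k \<sigma> \<and> is_rep G l \<tau> \<and>
    (\<forall>g\<in>carrier G. (\<Sum>i<n. \<rho> g $$ (i, i)) = (\<Sum>i<k. \<sigma> g $$ (i, i)) + (\<Sum>i<l. \<tau> g $$ (i, i)))"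
proof -
  interpret group G by fact
  have Wc: "W \<subseteq> carrier_vec n" and W0': "0\<^sub>v n \<in> W"
    using W unfolding VectorSpace.subspace_def submodule_def by (auto simp: module_vec_simps)
  obtain P Q J where P: "P \<in> carrier_mat n n" and Q: "Q \<in> carrier_mat n n" and PQ: "P * Q = 1\<^sub>m n"
    and QP: "Q * P = 1\<^sub>m n" and J: "J \<subseteq> {..<n}" and PJ: "\<And>j. j \<in> J \<Longrightarrow> col P j \<in> W"
    and QW: "\<And>w i. w \<in> W \<Longrightarrow> i < n \<Longrightarrow> i \<notin> J \<Longrightarrow> (Q *\<^sub>v w) $ i = 0"
    by (rule subspace_adapted_basis[OF W]) blast
  define \<pi> where "\<pi> g = Q * \<rho> g * P" for g
  have rc: "\<rho> g \<in> carrier_mat n n" if "g \<in> carrier G" for g using is_rep_carrier[OF rep that] .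
  have rep': "is_rep G n \<pi>"
  proof (rule is_repI[OF G])
    fix g h assume g: "g \<in> carrier G" and h: "h \<in> carrier G"
    have "\<pi> g * \<pi> h = Q * \<rho> g * (P * (Q * \<rho> h * P))"
      unfolding \<pi>_def using Q P rc[OF g] rc[OF h] by (intro assoc_mult_mat) auto
    also have "P * (Q * \<rho> h * P) = (P * Q) * (\<rho> h * P)"
      using Q P rc[OF h] by (simp add: assoc_mult_mat[of _ n n _ n _ n])
    also have "\<dots> = \<rho> h * P" using PQ P rc[OF h] by simp
    also have "Q * \<rho> g * (\<rho> h * P) = Q * (\<rho> g * \<rho> h) * P"
      using Q P rc[OF g] rc[OF h] by (simp add: assoc_mult_mat[of _ n n _ n _ n])
    finally show "\<pi> (g \<otimes> h) = \<pi> g * \<pi> h"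
      by (simp add: \<pi>_def is_rep_mult[OF rep g h])
  qed (use P Q rc QP is_rep_one[OF G rep] in \<open>auto simp: \<pi>_def\<close>)
  have tr: "(\<Sum>i<n. \<rho> g $$ (i, i)) = (\<Sum>i\<in>J. \<pi> g $$ (i, i)) + (\<Sum>i\<in>{..<n} - J. \<pi> g $$ (i, i))"
    if "g \<in> carrier G" for g
    using trace_similar[OF rc[OF that] Q P PQ] sum.subset_diff[OF J, of "\<lambda>i. \<pi> g $$ (i, i)"]
    by (simp add: \<pi>_def)
  have z: "\<pi> g $$ (i, j) = 0" if g: "g \<in> carrier G" and ij: "i < n" "j < n" "i \<notin> J" "j \<in> J" for g i j
  proof -
    have "\<pi> g = Q * (\<rho> g * P)" using Q P rc[OF g] by (simp add: \<pi>_def assoc_mult_mat[of _ n n _ n _ n])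
    hence "\<pi> g $$ (i, j) = row Q i \<bullet> col (\<rho> g * P) j"
      using ij Q P rc[OF g] by (simp del: col_mult2)
    also have "\<dots> = (Q *\<^sub>v (\<rho> g *\<^sub>v col P j)) $ i"
      unfolding col_mult2[OF rc[OF g] P ij(2)] using ij Q by simp
    finally have "\<pi> g $$ (i, j) = (Q *\<^sub>v (\<rho> g *\<^sub>v col P j)) $ i" .
    thus ?thesis using QW inv[OF g PJ] ij by simp
  qed
  have "J \<noteq> {}"
  proof
    assume "J = {}"
    have "w = 0\<^sub>v n" if w: "w \<in> W" for w
    proof -
      have wc: "w \<in> carrier_vec n" using w Wc by blast
      have "Q *\<^sub>v w = 0\<^sub>v n" using QW[OF w] \<open>J = {}\<close> Q wc by (intro eq_vecI) auto
      hence "P *\<^sub>v (Q *\<^sub>v w) = 0\<^sub>v n" using P by (auto intro!: eq_vecI)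
      thus ?thesis using wc P Q PQ by (simp add: assoc_mult_mat_vec[symmetric])
    qed
    thus False using W0 W0' by blast
  qed
  moreover have "J \<noteq> {..<n}"
  proof
    assume J_eq: "J = {..<n}"
    have "v \<in> W" if v: "v \<in> carrier_vec n" for v
    proof -
      have "P *\<^sub>v (Q *\<^sub>v v) \<in> W"
        using PJ J_eq Q v by (intro subspace_mult_mat_vec[OF W P]) auto
      thus ?thesis using v P Q PQ by (simp add: assoc_mult_mat_vec[symmetric])
    qed
    thus False using W1 Wc by blast
  qed
  ultimately have c: "card J < n" "card ({..<n} - J) < n"
    using J psubset_card_mono[of "{..<n}" J] psubset_card_mono[of "{..<n}" "{..<n} - J"] by auto
  obtain \<sigma> where \<sigma>: "is_rep G (card J) \<sigma>"
      "\<And>g. g \<in> carrier G \<Longrightarrow> (\<Sum>i<card J. \<sigma> g $$ (i, i)) = (\<Sum>i\<in>J. \<pi> g $$ (i, i))"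
    using is_rep_compress[OF G rep' J] z by auto
  obtain \<tau> where \<tau>: "is_rep G (card ({..<n} - J)) \<tau>"
      "\<And>g. g \<in> carrier G \<Longrightarrow>
        (\<Sum>i<card ({..<n} - J). \<tau> g $$ (i, i)) = (\<Sum>i\<in>{..<n} - J. \<pi> g $$ (i, i))"
    using is_rep_compress[OF G rep', of "{..<n} - J"] z by auto
  show ?thesis
    by (intro exI[of _ "card J"] exI[of _ "card ({..<n} - J)"] exI[of _ \<sigma>] exI[of _ \<tau>])
      (simp add: c \<sigma> \<tau> tr)
qed

lemma rep_char_sum_of_Irr:
  fixes G :: "('a, 'b) monoid_scheme" (structure)
  assumes G: "group G" and rep: "is_rep G n \<rho>"
  shows "\<exists>\<chi>s. set \<chi>s \<subseteq> Irr G \<and> (\<forall>g\<in>carrier G. (\<Sum>i<n. \<rho> g $$ (i, i)) = (\<Sum>\<chi>\<leftarrow>\<chi>s. \<chi> g))"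
  using rep
proof (induction n arbitrary: \<rho> rule: less_induct)
  case (less n)
  consider "n = 0" | "irreducible_rep G n \<rho>" | "n > 0" "\<not> irreducible_rep G n \<rho>" by blast
  then show ?case
  proof cases
    case 1
    thus ?thesis by (intro exI[of _ "[]"]) auto
  next
    case 2
    hence "rep_char G n \<rho> \<in> Irr G" unfolding Irr_def by blast
    thus ?thesis by (intro exI[of _ "[rep_char G n \<rho>]"]) (auto simp: rep_char_def)
  next
    case 3
    then obtain W where W: "VectorSpace.subspace class_ring W (module_vec TYPE(complex) n)"
      and inv: "\<forall>g\<in>carrier G. \<forall>w\<in>W. \<rho> g *\<^sub>v w \<in> W"
      and ne: "W \<noteq> {0\<^sub>v n}" "W \<noteq> carrier_vec n"
      using less.prems unfolding irreducible_rep_def by auto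
    from reducible_rep_char_splits[OF G less.prems W _ ne] inv obtain k l \<sigma> \<tau>
      where kl: "k < n" "l < n" and st: "is_rep G k \<sigma>" "is_rep G l \<tau>"
      and tr: "\<forall>g\<in>carrier G. (\<Sum>i<n. \<rho> g $$ (i, i)) = (\<Sum>i<k. \<sigma> g $$ (i, i)) + (\<Sum>i<l. \<tau> g $$ (i, i))"
      by blast
    obtain xs ys where "set xs \<subseteq> Irr G" "\<forall>g\<in>carrier G. (\<Sum>i<k. \<sigma> g $$ (i, i)) = (\<Sum>\<chi>\<leftarrow>xs. \<chi> g)"
      "set ys \<subseteq> Irr G" "\<forall>g\<in>carrier G. (\<Sum>i<l. \<tau> g $$ (i, i)) = (\<Sum>\<chi>\<leftarrow>ys. \<chi> g)"
      using less.IH[OF kl(1) st(1)] less.IH[OF kl(2) st(2)] by blast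
    thus ?thesis using tr by (intro exI[of _ "xs @ ys"]) auto
  qed
qed

text \<open>Schur's lemma: an eigenspace of \<open>A\<close> is invariant and nonzero.\<close>

lemma schur_scalar:
  assumes irr: "irreducible_rep G n \<rho>" and A: "A \<in> carrier_mat n n"
    and comm: "\<And>g. g \<in> carrier G \<Longrightarrow> \<rho> g * A = A * \<rho> g"
  shows "\<exists>c. A = c \<cdot>\<^sub>m 1\<^sub>m n"
proof -
  have n: "n > 0" and rep: "is_rep G n \<rho>" using irr by (auto simp: irreducible_rep_def)
  obtain as where as: "char_poly A = (\<Prod>a\<leftarrow>as. [:- a, 1:])" "length as = n"
    using char_poly_factorized[OF A] by blast
  then obtain c where "poly (char_poly A) c = 0"
    using n by (cases as) auto
  then obtain v where v: "v \<in> carrier_vec n" "v \<noteq> 0\<^sub>v n" "A *\<^sub>v v = c \<cdot>\<^sub>v v"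
    using eigenvalue_root_char_poly[OF A] A by (auto simp: eigenvalue_def eigenvector_def)
  define W where "W = {v \<in> carrier_vec n. A *\<^sub>v v = c \<cdot>\<^sub>v v}"
  have "VectorSpace.subspace class_ring W (module_vec TYPE(complex) n)"
    unfolding VectorSpace.subspace_def submodule_def
  proof (intro conjI allI impI)
    fix a x assume "x \<in> W"
    thus "a \<odot>\<^bsub>module_vec TYPE(complex) n\<^esub> x \<in> W"
      using A by (auto simp: W_def module_vec_simps mult_mat_vec smult_smult_assoc mult.commute)
  qed (use A vec_vs vec_module in \<open>auto simp: W_def module_vec_simps mult_add_distrib_mat_vec smult_add_distrib_vec
         intro: vec_vs vec_module\<close>)
  moreover have "\<rho> g *\<^sub>v w \<in> W" if g: "g \<in> carrier G" and w: "w \<in> W" for g w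
  proof -
    have R: "\<rho> g \<in> carrier_mat n n" using rep g by (rule is_rep_carrier)
    have wc: "w \<in> carrier_vec n" using w by (simp add: W_def)
    have "A *\<^sub>v (\<rho> g *\<^sub>v w) = (A * \<rho> g) *\<^sub>v w" using A R wc by simp
    also have "\<dots> = \<rho> g *\<^sub>v (A *\<^sub>v w)" using A R wc comm[OF g] by (metis assoc_mult_mat_vec)
    also have "\<dots> = c \<cdot>\<^sub>v (\<rho> g *\<^sub>v w)" using w R wc by (simp add: W_def mult_mat_vec)
    finally show ?thesis using R wc by (simp add: W_def)
  qed
  moreover have "W \<noteq> {0\<^sub>v n}" using v by (auto simp: W_def)
  ultimately have W: "W = carrier_vec n" using irr unfolding irreducible_rep_def by blast
  have "A = c \<cdot>\<^sub>m 1\<^sub>m n"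
  proof (rule eq_matI)
    fix i j assume "i < dim_row (c \<cdot>\<^sub>m 1\<^sub>m n)" "j < dim_col (c \<cdot>\<^sub>m 1\<^sub>m n :: complex mat)"
    hence i: "i < n" and j: "j < n" by auto
    have "unit_vec n j \<in> W" using W by simp
    hence "A *\<^sub>v unit_vec n j = c \<cdot>\<^sub>v unit_vec n j" by (simp add: W_def)
    hence "(A *\<^sub>v unit_vec n j) $ i = (c \<cdot>\<^sub>v unit_vec n j) $ i" by simp
    moreover have "(A *\<^sub>v unit_vec n j) $ i = A $$ (i, j)"
      using A i j by (simp add: scalar_prod_right_unit)
    ultimately show "A $$ (i, j) = (c \<cdot>\<^sub>m 1\<^sub>m n) $$ (i, j)" using i j by (simp add: unit_vec_def)
  qed (use A in auto)
  thus ?thesis ..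
qed

section \<open>Completeness of the irreducible characters\<close>

lemma (in group) mult_inv_cancel_left:
  assumes "g \<in> carrier G" "x \<in> carrier G"
  shows "g \<otimes> (inv g \<otimes> x) = x" "inv g \<otimes> (g \<otimes> x) = x"
  using assms by (simp_all add: m_assoc[symmetric])

lemma (in normal) conj_mem_iff:
  assumes "g \<in> carrier G" "x \<in> carrier G"
  shows "g \<otimes> x \<otimes> inv g \<in> H \<longleftrightarrow> x \<in> H"
proof
  assume "g \<otimes> x \<otimes> inv g \<in> H"
  from inv_op_closed1[OF assms(1) this] show "x \<in> H"
    using assms by (simp add: m_assoc mult_inv_cancel_left)
qed (use assms inv_op_closed2 in blast)

lemma sum_indicator_times:
  fixes F :: "'a \<Rightarrow> 'b::semiring_1"
  assumes "finite A" "B \<subseteq> A"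
  shows "(\<Sum>x\<in>A. (if x \<in> B then 1 else 0) * F x) = (\<Sum>x\<in>B. F x)"
proof -
  have "(\<Sum>x\<in>A. (if x \<in> B then 1 else 0) * F x) = (\<Sum>x\<in>A. if x \<in> B then F x else 0)"
    by (intro sum.cong refl) simp
  thus ?thesis using assms by (simp add: sum.If_cases Int_absorb1)
qed

text \<open>Class functions give central elements \<open>\<Sum>\<^sub>x f(x) x\<close> of the group algebra.\<close>

lemma group_average_commutes:
  fixes G :: "('a, 'b) monoid_scheme" (structure)
  assumes G: "group G" and rep: "is_rep G n \<rho>" and g: "g \<in> carrier G"
    and f: "\<And>x. x \<in> carrier G \<Longrightarrow> f (g \<otimes> x \<otimes> inv g) = f x"
  shows "\<rho> g * mat n n (\<lambda>(i, j). \<Sum>x\<in>carrier G. f x * \<rho> x $$ (i, j)) =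
    mat n n (\<lambda>(i, j). \<Sum>x\<in>carrier G. f x * \<rho> x $$ (i, j)) * \<rho> g" (is "\<rho> g * ?E = ?E * \<rho> g")
proof (rule eq_matI)
  interpret group G by fact
  have R: "\<rho> g \<in> carrier_mat n n" using rep g by (rule is_rep_carrier)
  fix i j assume "i < dim_row (?E * \<rho> g)" "j < dim_col (?E * \<rho> g)"
  hence i: "i < n" and j: "j < n" using R by auto
  have bij: "bij_betw (\<lambda>x. inv g \<otimes> x \<otimes> g) (carrier G) (carrier G)"
    using g by (intro bij_betw_byWitness[where f' = "\<lambda>x. g \<otimes> x \<otimes> inv g"])
      (auto simp: m_assoc mult_inv_cancel_left)
  have "(\<rho> g * ?E) $$ (i, j) = (\<Sum>k<n. \<Sum>x\<in>carrier G. f x * (\<rho> g $$ (i, k) * \<rho> x $$ (k, j)))"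
    using i j by (subst times_mat_entry[OF R _ i j]) (auto simp: sum_distrib_left ac_simps intro!: sum.cong)
  also have "\<dots> = (\<Sum>x\<in>carrier G. f x * \<rho> (g \<otimes> x) $$ (i, j))"
    using is_rep_entry_mult[OF rep g _ i j] by (subst sum.swap) (simp add: sum_distrib_left[symmetric])
  also have "\<dots> = (\<Sum>x\<in>carrier G. f (inv g \<otimes> x \<otimes> g) * \<rho> (g \<otimes> (inv g \<otimes> x \<otimes> g)) $$ (i, j))"
    by (rule sum.reindex_bij_betw[OF bij, symmetric])
  also have "\<dots> = (\<Sum>x\<in>carrier G. f x * \<rho> (x \<otimes> g) $$ (i, j))"
  proof (rule sum.cong[OF refl])
    fix x assume x: "x \<in> carrier G"
    have "g \<otimes> (inv g \<otimes> x \<otimes> g) = x \<otimes> g" using g x by (simp add: m_assoc mult_inv_cancel_left)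
    moreover have "f (inv g \<otimes> x \<otimes> g) = f x"
      using f[of "inv g \<otimes> x \<otimes> g"] g x by (simp add: m_assoc mult_inv_cancel_left)
    ultimately show "f (inv g \<otimes> x \<otimes> g) * \<rho> (g \<otimes> (inv g \<otimes> x \<otimes> g)) $$ (i, j) = f x * \<rho> (x \<otimes> g) $$ (i, j)"
      by simp
  qed
  also have "\<dots> = (\<Sum>k<n. \<Sum>x\<in>carrier G. f x * (\<rho> x $$ (i, k) * \<rho> g $$ (k, j)))"
    using is_rep_entry_mult[OF rep _ g i j] by (subst sum.swap) (simp add: sum_distrib_left[symmetric])
  also have "\<dots> = (?E * \<rho> g) $$ (i, j)"
    using i j by (subst times_mat_entry[OF _ R i j]) (auto simp: sum_distrib_right mult.assoc intro!: sum.cong)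
  finally show "(\<rho> g * ?E) $$ (i, j) = (?E * \<rho> g) $$ (i, j)" .
qed (use is_rep_carrier[OF rep g] in auto)

lemma Irr_obtain:
  assumes "\<chi> \<in> Irr G"
  obtains n \<rho> where "irreducible_rep G n \<rho>" "is_rep G n \<rho>" "n > 0"
    "\<And>g. g \<in> carrier G \<Longrightarrow> \<chi> g = (\<Sum>i<n. \<rho> g $$ (i, i))"
  using assms unfolding Irr_def rep_char_def irreducible_rep_def by auto

lemma Irr_conj:
  fixes G :: "('a, 'b) monoid_scheme" (structure)
  assumes G: "group G" and \<chi>: "\<chi> \<in> Irr G" and g: "g \<in> carrier G" and x: "x \<in> carrier G"
  shows "\<chi> (g \<otimes> x \<otimes> inv g) = \<chi> x"
proof -
  interpret group G by fact
  obtain n \<rho> where rep: "is_rep G n \<rho>" and ch: "\<And>g. g \<in> carrier G \<Longrightarrow> \<chi> g = (\<Sum>i<n. \<rho> g $$ (i, i))"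
    using Irr_obtain[OF \<chi>] by metis
  have "\<rho> (inv g) * \<rho> g = 1\<^sub>m n"
    using is_rep_mult[OF rep, of "inv g" g] is_rep_one[OF G rep] g by simp
  thus ?thesis
    using g x is_rep_carrier[OF rep] trace_similar[of "\<rho> x" n "\<rho> g" "\<rho> (inv g)"]
    by (simp add: ch is_rep_mult[OF rep])
qed

text \<open>The central element \<open>\<Sum>\<^sub>x f(x) x\<close> acts on an irreducible representation as a scalar, and
  orthogonality says that the trace of this scalar is zero. So it acts as zero, and multiplying by
  the matrix of \<open>y\<close> before taking the trace gives zero again.\<close>

lemma sum_class_function_Irr_shift:
  fixes G :: "('a, 'b) monoid_scheme" (structure)
  assumes G: "group G" and \<chi>: "\<chi> \<in> Irr G" and y: "y \<in> carrier G"
    and f: "\<And>g x. g \<in> carrier G \<Longrightarrow> x \<in> carrier G \<Longrightarrow> f (g \<otimes> x \<otimes> inv g) = f x"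
    and orth: "(\<Sum>x\<in>carrier G. f x * \<chi> x) = 0"
  shows "(\<Sum>x\<in>carrier G. f x * \<chi> (x \<otimes> y)) = 0"
proof -
  interpret group G by fact
  obtain n \<rho> where irr: "irreducible_rep G n \<rho>" and rep: "is_rep G n \<rho>" and n: "n > 0"
    and ch: "\<And>g. g \<in> carrier G \<Longrightarrow> \<chi> g = (\<Sum>i<n. \<rho> g $$ (i, i))"
    using Irr_obtain[OF \<chi>] by metis
  define E where "E = mat n n (\<lambda>(i, j). \<Sum>x\<in>carrier G. f x * \<rho> x $$ (i, j))"
  have E: "E \<in> carrier_mat n n" by (simp add: E_def)
  obtain c where c: "E = c \<cdot>\<^sub>m 1\<^sub>m n"
    using schur_scalar[OF irr E] group_average_commutes[OF G rep, where f = f] f unfolding E_def by blast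
  have "of_nat n * c = (\<Sum>i<n. E $$ (i, i))" by (simp add: c)
  also have "\<dots> = (\<Sum>x\<in>carrier G. f x * \<chi> x)"
    by (simp add: E_def ch sum_distrib_left) (rule sum.swap)
  finally have c0: "c = 0" using n orth by simp
  have E0: "(\<Sum>x\<in>carrier G. f x * \<rho> x $$ (i, k)) = 0" if "i < n" "k < n" for i k
  proof -
    have "(\<Sum>x\<in>carrier G. f x * \<rho> x $$ (i, k)) = E $$ (i, k)" using that by (simp add: E_def)
    thus ?thesis using that c c0 by simp
  qed
  have "(\<Sum>x\<in>carrier G. f x * \<chi> (x \<otimes> y)) =
      (\<Sum>x\<in>carrier G. \<Sum>i<n. \<Sum>k<n. f x * \<rho> x $$ (i, k) * \<rho> y $$ (k, i))"
    using y by (intro sum.cong refl) (simp add: ch is_rep_entry_mult[OF rep _ y] sum_distrib_left mult.assoc)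
  also have "\<dots> = (\<Sum>i<n. \<Sum>x\<in>carrier G. \<Sum>k<n. f x * \<rho> x $$ (i, k) * \<rho> y $$ (k, i))"
    by (rule sum.swap)
  also have "\<dots> = (\<Sum>i<n. \<Sum>k<n. \<Sum>x\<in>carrier G. f x * \<rho> x $$ (i, k) * \<rho> y $$ (k, i))"
    by (intro sum.cong refl sum.swap)
  also have "\<dots> = (\<Sum>i<n. \<Sum>k<n. (\<Sum>x\<in>carrier G. f x * \<rho> x $$ (i, k)) * \<rho> y $$ (k, i))"
    by (simp add: sum_distrib_right)
  also have "\<dots> = 0" using E0 by (intro sum.neutral ballI) simp
  finally show ?thesis .
qed

text \<open>The regular representation, as permutation matrices for an enumeration of the group.\<close>

lemma regular_rep_exists:
  fixes G :: "('a, 'b) monoid_scheme" (structure)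
  assumes G: "group G" and fin: "finite (carrier G)"
  shows "\<exists>n \<rho>. is_rep G n \<rho> \<and>
    (\<forall>g\<in>carrier G. (\<Sum>i<n. \<rho> g $$ (i, i)) = (if g = \<one> then of_nat (card (carrier G)) else 0))"
proof -
  interpret group G by fact
  define n where "n = card (carrier G)"
  obtain e where e: "bij_betw e {..<n} (carrier G)"
    using ex_bij_betw_nat_finite[OF fin] by (auto simp: atLeast0LessThan n_def)
  have ec: "e i \<in> carrier G" if "i < n" for i using that bij_betwE[OF e] by simp
  have inj: "e i = e j \<longleftrightarrow> i = j" if "i < n" "j < n" for i j
    using that bij_betw_imp_inj_on[OF e] by (auto dest: inj_onD)
  define \<rho> :: "'a \<Rightarrow> complex mat"
    where "\<rho> g = mat n n (\<lambda>(i, j). if e i = g \<otimes> e j then 1 else 0)" for g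
  have "is_rep G n \<rho>"
  proof (rule is_repI[OF G])
    fix g h assume g: "g \<in> carrier G" and h: "h \<in> carrier G"
    show "\<rho> (g \<otimes> h) = \<rho> g * \<rho> h"
    proof (rule eq_matI)
      fix i j assume "i < dim_row (\<rho> g * \<rho> h)" "j < dim_col (\<rho> g * \<rho> h)"
      hence i: "i < n" and j: "j < n" by (auto simp: \<rho>_def)
      have "h \<otimes> e j \<in> e ` {..<n}" using h ec[OF j] bij_betw_imp_surj_on[OF e] by simp
      then obtain m where m: "m < n" "e m = h \<otimes> e j" by auto
      have "(\<rho> g * \<rho> h) $$ (i, j) = (\<Sum>k<n. \<rho> g $$ (i, k) * \<rho> h $$ (k, j))"
        using i j by (intro times_mat_entry) (auto simp: \<rho>_def)
      also have "\<dots> = (\<Sum>k<n. if k = m then \<rho> g $$ (i, m) else 0)"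
        using i j m inj by (intro sum.cong refl) (auto simp: \<rho>_def simp flip: m(2))
      also have "\<dots> = \<rho> g $$ (i, m)" using m by simp
      also have "\<dots> = \<rho> (g \<otimes> h) $$ (i, j)"
        using i j m g h ec by (simp add: \<rho>_def m_assoc)
      finally show "\<rho> (g \<otimes> h) $$ (i, j) = (\<rho> g * \<rho> h) $$ (i, j)" by simp
    qed (auto simp: \<rho>_def)
  next
    show "\<rho> \<one> = 1\<^sub>m n" using ec inj by (intro eq_matI) (auto simp: \<rho>_def)
  qed (auto simp: \<rho>_def)
  moreover have "(\<Sum>i<n. \<rho> g $$ (i, i)) = (if g = \<one> then of_nat (card (carrier G)) else 0)"
    if g: "g \<in> carrier G" for g
  proof -
    have "e i = g \<otimes> e i \<longleftrightarrow> g = \<one>" if "i < n" for i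
      using g ec[OF that] by simp
    hence "(\<Sum>i<n. \<rho> g $$ (i, i)) = (\<Sum>i<n. if g = \<one> then 1 else 0)"
      by (intro sum.cong refl) (auto simp: \<rho>_def)
    thus ?thesis by (simp add: n_def)
  qed
  ultimately show ?thesis by blast
qed

text \<open>Completeness of the irreducible characters. By the preceding lemmas
  \<open>\<Sum>\<^sub>x f(x) \<psi>(x y) = 0\<close> holds for every irreducible \<open>\<psi>\<close>, hence for the character of every
  representation; for the regular one the sum is \<open>|G| f(y\<^sup>-\<^sup>1)\<close>.\<close>

theorem class_function_orthogonal_to_Irr_zero:
  fixes G :: "('a, 'b) monoid_scheme" (structure)
  assumes G: "group G" and fin: "finite (carrier G)"
    and f: "\<And>g x. g \<in> carrier G \<Longrightarrow> x \<in> carrier G \<Longrightarrow> f (g \<otimes> x \<otimes> inv g) = f x"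
    and orth: "\<And>\<chi>. \<chi> \<in> Irr G \<Longrightarrow> (\<Sum>x\<in>carrier G. f x * \<chi> x) = 0"
    and z: "z \<in> carrier G"
  shows "f z = 0"
proof -
  interpret group G by fact
  obtain n \<rho> where rep: "is_rep G n \<rho>"
    and tr: "\<And>g. g \<in> carrier G \<Longrightarrow> (\<Sum>i<n. \<rho> g $$ (i, i)) = (if g = \<one> then of_nat (card (carrier G)) else 0)"
    using regular_rep_exists[OF G fin] by blast
  obtain \<chi>s where irr: "set \<chi>s \<subseteq> Irr G"
    and sum: "\<And>g. g \<in> carrier G \<Longrightarrow> (\<Sum>i<n. \<rho> g $$ (i, i)) = (\<Sum>\<chi>\<leftarrow>\<chi>s. \<chi> g)"
    using rep_char_sum_of_Irr[OF G rep] by blast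
  have shift: "(\<Sum>x\<in>carrier G. f x * (\<Sum>\<chi>\<leftarrow>\<chi>s. \<chi> (x \<otimes> inv z))) = 0"
    using irr
  proof (induction \<chi>s)
    case (Cons \<chi> \<chi>s)
    have "(\<Sum>x\<in>carrier G. f x * \<chi> (x \<otimes> inv z)) = 0"
      using Cons.prems z by (intro sum_class_function_Irr_shift[OF G]) (auto simp: f orth)
    thus ?case using Cons by (simp add: distrib_left sum.distrib)
  qed simp
  have "x \<otimes> inv z = \<one> \<longleftrightarrow> x = z" if "x \<in> carrier G" for x
    using that z by (metis inv_closed inv_inv inv_unique' r_inv inv_equality)
  hence "(\<Sum>x\<in>carrier G. f x * (\<Sum>\<chi>\<leftarrow>\<chi>s. \<chi> (x \<otimes> inv z))) =
      (\<Sum>x\<in>carrier G. if x = z then f z * of_nat (card (carrier G)) else 0)"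
    using z by (intro sum.cong refl) (simp add: sum[symmetric] tr)
  hence "f z * of_nat (card (carrier G)) = 0" using shift z fin by simp
  thus ?thesis using z fin by auto
qed

section \<open>Kernel and center of an irreducible character\<close>

definition commutators_with :: "('a, 'b) monoid_scheme \<Rightarrow> 'a \<Rightarrow> 'a set" where
  "commutators_with G g = (\<lambda>x. x \<otimes>\<^bsub>G\<^esub> g \<otimes>\<^bsub>G\<^esub> inv\<^bsub>G\<^esub> x \<otimes>\<^bsub>G\<^esub> inv\<^bsub>G\<^esub> g) ` carrier G"

lemma is_rep_pow:
  fixes G :: "('a, 'b) monoid_scheme" (structure)
  assumes G: "group G" and rep: "is_rep G n \<rho>" and g: "g \<in> carrier G"
  shows "\<rho> (g [^] (k::nat)) = \<rho> g ^\<^sub>m k"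
proof -
  interpret group G by fact
  show ?thesis
    using is_rep_carrier[OF rep g] g
    by (induction k) (auto simp: is_rep_one[OF G rep] is_rep_mult[OF rep])
qed

text \<open>A character together with a chosen irreducible representation that affords it. Outside the
  group the values of \<open>\<chi>\<close> are left open.\<close>

locale irreducible_character = group G for G :: "('a, 'b) monoid_scheme" (structure) +
  fixes \<chi> n \<rho>
  assumes finite_carrier: "finite (carrier G)"
    and irr: "irreducible_rep G n \<rho>"
    and char: "g \<in> carrier G \<Longrightarrow> \<chi> g = (\<Sum>i<n. \<rho> g $$ (i, i))"
begin

lemma rep: "is_rep G n \<rho>" and degree_pos: "n > 0"
  using irr by (auto simp: irreducible_rep_def)

lemmas rep_carrier = is_rep_carrier[OF rep]
  and rep_mult = is_rep_mult[OF rep]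
  and rep_one = is_rep_one[OF is_group rep]

lemma char_one: "\<chi> \<one> = of_nat n"
  using char[OF one_closed] rep_one by simp

lemma rep_finite_order:
  assumes "g \<in> carrier G"
  shows "\<rho> g ^\<^sub>m card (carrier G) = 1\<^sub>m n"
  using is_rep_pow[OF is_group rep assms, of "card (carrier G)"] pow_order_eq_1[OF assms] rep_one
  by (simp add: Coset.order_def)

lemma card_carrier_pos: "card (carrier G) > 0"
  using finite_carrier by (auto simp: card_gt_0_iff)

text \<open>Eigenvalues of \<open>\<rho>(g)\<close> are roots of unity, so scalars have trace of modulus \<open>n\<close>, and conversely
  by the extremal case of the triangle inequality.\<close>

lemma rep_scalar_iff:
  assumes g: "g \<in> carrier G"
  shows "(\<exists>c. \<rho> g = c \<cdot>\<^sub>m 1\<^sub>m n) \<longleftrightarrow> cmod (\<chi> g) = real n"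
proof
  assume "\<exists>c. \<rho> g = c \<cdot>\<^sub>m 1\<^sub>m n"
  then obtain c where c: "\<rho> g = c \<cdot>\<^sub>m 1\<^sub>m n" ..
  have "(c \<cdot>\<^sub>m 1\<^sub>m n) ^\<^sub>m k = c ^ k \<cdot>\<^sub>m 1\<^sub>m n" for k
    by (induction k) (auto simp: mult_smult_distrib[OF _ one_carrier_mat] mult.commute intro!: eq_matI)
  hence "c ^ card (carrier G) \<cdot>\<^sub>m 1\<^sub>m n = 1\<^sub>m n" using rep_finite_order[OF g] c by simp
  hence "(c ^ card (carrier G) \<cdot>\<^sub>m 1\<^sub>m n) $$ (0, 0) = (1\<^sub>m n :: complex mat) $$ (0, 0)" by simp
  hence "c ^ card (carrier G) = 1" using degree_pos by simp
  hence "cmod c ^ card (carrier G) = 1" by (metis norm_one norm_power)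
  hence "cmod c = 1" using card_carrier_pos power_eq_imp_eq_base[of "cmod c" "card (carrier G)" 1] by simp
  thus "cmod (\<chi> g) = real n" using char[OF g] c by (simp add: norm_mult)
next
  assume "cmod (\<chi> g) = real n"
  thus "\<exists>c. \<rho> g = c \<cdot>\<^sub>m 1\<^sub>m n"
    using finite_order_extremal_trace_scalar[OF rep_carrier[OF g] degree_pos card_carrier_pos rep_finite_order[OF g]]
      char[OF g] by simp
qed

lemma char_ker_iff: "g \<in> char_ker G \<chi> \<longleftrightarrow> g \<in> carrier G \<and> \<rho> g = 1\<^sub>m n"
proof (cases "g \<in> carrier G")
  case g: True
  have "\<rho> g = 1\<^sub>m n" if eq: "\<chi> g = of_nat n"
  proof -
    obtain c where c: "\<rho> g = c \<cdot>\<^sub>m 1\<^sub>m n" using rep_scalar_iff[OF g] eq by auto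
    hence "of_nat n * c = of_nat n" using char[OF g] eq by simp
    hence "c = 1" using degree_pos by simp
    thus ?thesis using c by (auto intro!: eq_matI)
  qed
  thus ?thesis using g char[OF g] by (auto simp: char_ker_def char_one)
qed (simp add: char_ker_def)

lemma char_center_iff_scalar: "g \<in> char_center G \<chi> \<longleftrightarrow> g \<in> carrier G \<and> (\<exists>c. \<rho> g = c \<cdot>\<^sub>m 1\<^sub>m n)"
proof -
  have "complex_of_real (cmod (\<chi> g)) = of_nat n \<longleftrightarrow> cmod (\<chi> g) = real n"
    by (metis of_real_eq_iff of_real_of_nat_eq)
  thus ?thesis using rep_scalar_iff by (auto simp: char_center_def char_one)
qed

lemma char_ker_normal: "char_ker G \<chi> \<lhd> G"
proof (rule normal_invI)
  have inv: "\<rho> (inv g) = 1\<^sub>m n" if "g \<in> carrier G" "\<rho> g = 1\<^sub>m n" for g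
    using that rep_mult[of g "inv g"] rep_one rep_carrier[of "inv g"] by simp
  show "subgroup (char_ker G \<chi>) G"
  proof (rule subgroupI)
    have "\<one> \<in> char_ker G \<chi>" by (simp add: char_ker_iff rep_one)
    thus "char_ker G \<chi> \<noteq> {}" by blast
  qed (auto simp: char_ker_iff rep_mult inv)
  fix x h assume x: "x \<in> carrier G" and h: "h \<in> char_ker G \<chi>"
  have "\<rho> x * \<rho> (inv x) = 1\<^sub>m n" using x rep_mult[of x "inv x"] rep_one by simp
  thus "x \<otimes> h \<otimes> inv x \<in> char_ker G \<chi>"
    using x h rep_carrier[OF x] by (auto simp: char_ker_iff rep_mult)
qed

lemma char_ker_translate:
  assumes "m \<in> char_ker G \<chi>" "x \<in> carrier G"
  shows "\<chi> (m \<otimes> x) = \<chi> x"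
  using assms rep_carrier[of x] by (simp add: char_ker_iff char rep_mult)

text \<open>\<open>Z(\<chi>) / ker \<chi>\<close> is the center of \<open>G / ker \<chi>\<close>: by Schur's lemma \<open>\<rho>(g)\<close> is scalar as soon as it
  commutes with all \<open>\<rho>(x)\<close>.\<close>

lemma char_center_iff: "g \<in> char_center G \<chi> \<longleftrightarrow> g \<in> carrier G \<and> commutators_with G g \<subseteq> char_ker G \<chi>"
proof (cases "g \<in> carrier G")
  case g: True
  have comm: "\<rho> (x \<otimes> g \<otimes> inv x \<otimes> inv g) = 1\<^sub>m n \<longleftrightarrow> \<rho> x * \<rho> g = \<rho> g * \<rho> x" if x: "x \<in> carrier G" for x
  proof
    assume one: "\<rho> (x \<otimes> g \<otimes> inv x \<otimes> inv g) = 1\<^sub>m n"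
    have "x \<otimes> g = (x \<otimes> g \<otimes> inv x \<otimes> inv g) \<otimes> (g \<otimes> x)"
      using x g by (simp add: m_assoc mult_inv_cancel_left)
    hence "\<rho> (x \<otimes> g) = \<rho> (x \<otimes> g \<otimes> inv x \<otimes> inv g) * \<rho> (g \<otimes> x)"
      using x g rep_mult[of "x \<otimes> g \<otimes> inv x \<otimes> inv g" "g \<otimes> x"] by simp
    also have "\<dots> = \<rho> (g \<otimes> x)"
      unfolding one by (rule left_mult_one_mat[OF rep_carrier]) (use x g in simp)
    finally show "\<rho> x * \<rho> g = \<rho> g * \<rho> x" using x g by (simp add: rep_mult)
  next
    assume "\<rho> x * \<rho> g = \<rho> g * \<rho> x"
    hence eq: "\<rho> (x \<otimes> g) = \<rho> (g \<otimes> x)" using x g by (simp add: rep_mult)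
    have "\<rho> (x \<otimes> g \<otimes> inv x \<otimes> inv g) = \<rho> ((x \<otimes> g) \<otimes> (inv x \<otimes> inv g))"
      using x g by (simp add: m_assoc)
    also have "\<dots> = \<rho> ((g \<otimes> x) \<otimes> (inv x \<otimes> inv g))"
      using x g eq by (subst (1 2) rep_mult) auto
    also have "(g \<otimes> x) \<otimes> (inv x \<otimes> inv g) = \<one>"
      using x g by (simp add: m_assoc mult_inv_cancel_left)
    finally show "\<rho> (x \<otimes> g \<otimes> inv x \<otimes> inv g) = 1\<^sub>m n" by (simp add: rep_one)
  qed
  have "(\<exists>c. \<rho> g = c \<cdot>\<^sub>m 1\<^sub>m n) \<longleftrightarrow> (\<forall>x\<in>carrier G. \<rho> x * \<rho> g = \<rho> g * \<rho> x)"
  proof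
    assume "\<exists>c. \<rho> g = c \<cdot>\<^sub>m 1\<^sub>m n"
    then obtain c where c: "\<rho> g = c \<cdot>\<^sub>m 1\<^sub>m n" ..
    show "\<forall>x\<in>carrier G. \<rho> x * \<rho> g = \<rho> g * \<rho> x"
    proof
      fix x assume "x \<in> carrier G"
      hence R: "\<rho> x \<in> carrier_mat n n" by (rule rep_carrier)
      show "\<rho> x * \<rho> g = \<rho> g * \<rho> x"
        unfolding c mult_smult_distrib[OF R one_carrier_mat] mult_smult_assoc_mat[OF one_carrier_mat R]
        using R by simp
    qed
  qed (use schur_scalar[OF irr rep_carrier[OF g]] in blast)
  thus ?thesis using g comm unfolding char_center_iff_scalar
    by (auto simp: commutators_with_def char_ker_iff image_subset_iff)
qed (simp add: char_center_def)

text \<open>The operator \<open>E = \<Sum>\<^bsub>x\<in>N\<^esub> \<rho>(x)\<close> is a scalar \<open>c\<close> by Schur's lemma. It is fixed by multiplication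
  with \<open>\<rho>(m)\<close> for \<open>m \<in> N\<close>, so \<open>c \<noteq> 0\<close> would make \<open>\<rho>(m)\<close> the identity for all \<open>m \<in> N\<close>.\<close>

lemma sum_normal_zero:
  assumes N: "N \<lhd> G" and nker: "\<not> N \<subseteq> char_ker G \<chi>"
  shows "(\<Sum>m\<in>N. \<chi> m) = 0"
proof -
  interpret N: normal N G by fact
  have Nc: "N \<subseteq> carrier G" by (rule N.subset)
  define f :: "'a \<Rightarrow> complex" where "f x = (if x \<in> N then 1 else 0)" for x
  define E where "E = mat n n (\<lambda>(i, j). \<Sum>x\<in>carrier G. f x * \<rho> x $$ (i, j))"
  have E: "E \<in> carrier_mat n n" by (simp add: E_def)
  have f_sum: "(\<Sum>x\<in>carrier G. f x * F x) = (\<Sum>x\<in>N. F x)" for F :: "'a \<Rightarrow> complex"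
    unfolding f_def by (rule sum_indicator_times[OF finite_carrier Nc])
  have "\<rho> g * E = E * \<rho> g" if "g \<in> carrier G" for g
    unfolding E_def by (rule group_average_commutes[OF is_group rep that]) (simp add: f_def N.conj_mem_iff that)
  then obtain c where c: "E = c \<cdot>\<^sub>m 1\<^sub>m n" using schur_scalar[OF irr E] by blast
  obtain m where m: "m \<in> N" "m \<notin> char_ker G \<chi>" using nker by blast
  hence mc: "m \<in> carrier G" using Nc by blast
  have R: "\<rho> m \<in> carrier_mat n n" using mc by (rule rep_carrier)
  have "\<rho> m * E = E"
  proof (rule eq_matI)
    fix i j assume "i < dim_row E" "j < dim_col E"
    hence i: "i < n" and j: "j < n" using E by auto
    have bij: "bij_betw (\<lambda>x. m \<otimes> x) N N"
      using m mc Nc N.m_closed N.m_inv_closed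
      by (intro bij_betw_byWitness[where f' = "\<lambda>x. inv m \<otimes> x"])
        (auto simp: mult_inv_cancel_left subset_iff)
    have "(\<rho> m * E) $$ (i, j) = (\<Sum>k<n. \<Sum>x\<in>N. \<rho> m $$ (i, k) * \<rho> x $$ (k, j))"
      using i j by (subst times_mat_entry[OF R E i j]) (simp add: E_def f_sum sum_distrib_left)
    also have "\<dots> = (\<Sum>x\<in>N. \<rho> (m \<otimes> x) $$ (i, j))"
      by (subst sum.swap, intro sum.cong refl is_rep_entry_mult[OF rep mc _ i j, symmetric]) (use Nc in auto)
    also have "\<dots> = (\<Sum>x\<in>N. \<rho> x $$ (i, j))" by (rule sum.reindex_bij_betw[OF bij])
    also have "\<dots> = E $$ (i, j)" using i j by (simp add: E_def f_sum)
    finally show "(\<rho> m * E) $$ (i, j) = E $$ (i, j)" .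
  qed (use R E in auto)
  hence "c \<cdot>\<^sub>m \<rho> m = c \<cdot>\<^sub>m 1\<^sub>m n"
    unfolding c mult_smult_distrib[OF R one_carrier_mat] using R by simp
  have "c = 0"
  proof (rule ccontr)
    assume "c \<noteq> 0"
    hence "\<rho> m = inverse c \<cdot>\<^sub>m (c \<cdot>\<^sub>m \<rho> m)" by (auto intro!: eq_matI)
    also have "\<dots> = 1\<^sub>m n" unfolding \<open>c \<cdot>\<^sub>m \<rho> m = c \<cdot>\<^sub>m 1\<^sub>m n\<close> using \<open>c \<noteq> 0\<close> by (auto intro!: eq_matI)
    finally show False using m mc by (simp add: char_ker_iff)
  qed
  have "(\<Sum>x\<in>N. \<chi> x) = (\<Sum>x\<in>N. \<Sum>i<n. \<rho> x $$ (i, i))"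
    using Nc by (intro sum.cong refl char) auto
  also have "\<dots> = (\<Sum>i<n. \<Sum>x\<in>N. \<rho> x $$ (i, i))" by (rule sum.swap)
  also have "\<dots> = (\<Sum>i<n. E $$ (i, i))" by (simp add: E_def f_sum)
  also have "\<dots> = 0" by (simp add: c \<open>c = 0\<close>)
  finally show ?thesis .
qed

end

section \<open>Vanishing of characters and cosets in conjugacy classes\<close>

locale finite_group = group +
  assumes finite_carrier: "finite (carrier G)"
begin

lemma Irr_irreducible_character:
  assumes "\<chi> \<in> Irr G"
  obtains n \<rho> where "irreducible_character G \<chi> n \<rho>"
proof -
  obtain n \<rho> where "irreducible_rep G n \<rho>" "\<And>g. g \<in> carrier G \<Longrightarrow> \<chi> g = (\<Sum>i<n. \<rho> g $$ (i, i))"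
    using Irr_obtain[OF assms] by metis
  hence "irreducible_character G \<chi> n \<rho>"
    using finite_carrier by unfold_locales auto
  thus ?thesis by (rule that)
qed

lemma Irr_ker_normal: "\<chi> \<in> Irr G \<Longrightarrow> char_ker G \<chi> \<lhd> G"
  by (erule Irr_irreducible_character) (rule irreducible_character.char_ker_normal)

lemma Irr_ker_translate:
  "\<chi> \<in> Irr G \<Longrightarrow> m \<in> char_ker G \<chi> \<Longrightarrow> x \<in> carrier G \<Longrightarrow> \<chi> (m \<otimes> x) = \<chi> x"
  by (erule Irr_irreducible_character) (rule irreducible_character.char_ker_translate)

lemma Irr_center_iff:
  "\<chi> \<in> Irr G \<Longrightarrow> g \<in> char_center G \<chi> \<longleftrightarrow> g \<in> carrier G \<and> commutators_with G g \<subseteq> char_ker G \<chi>"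
  by (erule Irr_irreducible_character) (rule irreducible_character.char_center_iff)

lemma Irr_center_nonzero:
  assumes "\<chi> \<in> Irr G" "g \<in> char_center G \<chi>"
  shows "\<chi> g \<noteq> 0"
proof -
  obtain n \<rho> where "irreducible_character G \<chi> n \<rho>" using assms(1) by (rule Irr_irreducible_character)
  then interpret irreducible_character G \<chi> n \<rho> .
  show ?thesis using degree_pos char_one assms(2) by (auto simp: char_center_def)
qed

text \<open>An irreducible character is constant on the cosets of \<open>N\<close> or sums to zero over each of them.\<close>

lemma Irr_sum_normal_coset:
  assumes \<chi>: "\<chi> \<in> Irr G" and N: "N \<lhd> G" and y: "y \<in> carrier G"
  shows "(\<Sum>m\<in>N. \<chi> (m \<otimes> y)) = (if N \<subseteq> char_ker G \<chi> then of_nat (card N) * \<chi> y else 0)"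
proof (cases "N \<subseteq> char_ker G \<chi>")
  case True
  hence "(\<Sum>m\<in>N. \<chi> (m \<otimes> y)) = (\<Sum>m\<in>N. \<chi> y)"
    using Irr_ker_translate[OF \<chi> _ y] by (intro sum.cong refl) auto
  thus ?thesis using True by simp
next
  case False
  interpret N: normal N G by fact
  obtain n \<rho> where "irreducible_character G \<chi> n \<rho>" using \<chi> by (rule Irr_irreducible_character)
  then interpret \<chi>: irreducible_character G \<chi> n \<rho> .
  define f :: "'a \<Rightarrow> complex" where "f x = (if x \<in> N then 1 else 0)" for x
  have f_sum: "(\<Sum>x\<in>carrier G. f x * F x) = (\<Sum>x\<in>N. F x)" for F :: "'a \<Rightarrow> complex"
    unfolding f_def by (rule sum_indicator_times[OF finite_carrier N.subset])
  have "(\<Sum>x\<in>carrier G. f x * \<chi> (x \<otimes> y)) = 0"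
    using \<chi>.sum_normal_zero[OF N False]
    by (intro sum_class_function_Irr_shift[OF is_group \<chi> y]) (simp_all add: f_sum, simp add: f_def N.conj_mem_iff)
  thus ?thesis using False by (simp add: f_sum)
qed

text \<open>Replacing a function \<open>a\<close> by its sums over the cosets of \<open>N\<close> multiplies its inner product with
  \<open>\<chi>\<close> by \<open>|N|\<close> or by \<open>0\<close>, according to whether \<open>N\<close> lies in the kernel. This isolates the
  characters of \<open>G / N\<close> without forming the quotient.\<close>

lemma sum_translate_Irr:
  assumes \<chi>: "\<chi> \<in> Irr G" and N: "N \<lhd> G"
  shows "(\<Sum>x\<in>carrier G. (\<Sum>m\<in>N. a (m \<otimes> x)) * \<chi> x) =
    (if N \<subseteq> char_ker G \<chi> then of_nat (card N) * (\<Sum>x\<in>carrier G. a x * \<chi> x) else 0)"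
proof -
  interpret N: normal N G by fact
  have mc: "m \<in> carrier G" if "m \<in> N" for m using that N.subset by blast
  have bij: "bij_betw (\<lambda>x. inv m \<otimes> x) (carrier G) (carrier G)" if "m \<in> N" for m
    using mc[OF that] by (intro bij_betw_byWitness[where f' = "\<lambda>x. m \<otimes> x"]) (auto simp: mult_inv_cancel_left)
  have bij': "bij_betw (\<lambda>m. inv m) N N"
    using mc by (intro bij_betw_byWitness[where f' = "\<lambda>x. inv x"]) auto
  have "(\<Sum>x\<in>carrier G. (\<Sum>m\<in>N. a (m \<otimes> x)) * \<chi> x) = (\<Sum>m\<in>N. \<Sum>x\<in>carrier G. a (m \<otimes> x) * \<chi> x)"
    by (subst sum.swap) (simp add: sum_distrib_right)
  also have "\<dots> = (\<Sum>m\<in>N. \<Sum>x\<in>carrier G. a (m \<otimes> (inv m \<otimes> x)) * \<chi> (inv m \<otimes> x))"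
    by (intro sum.cong refl sum.reindex_bij_betw[OF bij, symmetric])
  also have "\<dots> = (\<Sum>m\<in>N. \<Sum>x\<in>carrier G. a x * \<chi> (inv m \<otimes> x))"
    using mc by (intro sum.cong refl) (simp add: mult_inv_cancel_left)
  also have "\<dots> = (\<Sum>m\<in>N. \<Sum>x\<in>carrier G. a x * \<chi> (m \<otimes> x))"
    by (rule sum.reindex_bij_betw[OF bij', of "\<lambda>m. \<Sum>x\<in>carrier G. a x * \<chi> (m \<otimes> x)"])
  also have "\<dots> = (\<Sum>x\<in>carrier G. a x * (\<Sum>m\<in>N. \<chi> (m \<otimes> x)))"
    by (subst sum.swap) (simp add: sum_distrib_left)
  also have "\<dots> = (\<Sum>x\<in>carrier G. a x * (if N \<subseteq> char_ker G \<chi> then of_nat (card N) * \<chi> x else 0))"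
    by (intro sum.cong refl) (simp add: Irr_sum_normal_coset[OF \<chi> N])
  also have "\<dots> = (if N \<subseteq> char_ker G \<chi> then of_nat (card N) * (\<Sum>x\<in>carrier G. a x * \<chi> x) else 0)"
    by (simp add: sum_distrib_left mult.left_commute)
  finally show ?thesis .
qed

lemma translate_class_function:
  assumes N: "N \<lhd> G" and a: "\<And>g x. g \<in> carrier G \<Longrightarrow> x \<in> carrier G \<Longrightarrow> a (g \<otimes> x \<otimes> inv g) = a x"
    and g: "g \<in> carrier G" and x: "x \<in> carrier G"
  shows "(\<Sum>m\<in>N. a (m \<otimes> (g \<otimes> x \<otimes> inv g))) = (\<Sum>m\<in>N. a (m \<otimes> x))"
proof -
  interpret N: normal N G by fact
  have mc: "m \<in> carrier G" if "m \<in> N" for m using that N.subset by blast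
  have bij: "bij_betw (\<lambda>m. g \<otimes> m \<otimes> inv g) N N"
    using g mc N.inv_op_closed1[OF g] N.inv_op_closed2[OF g]
    by (intro bij_betw_byWitness[where f' = "\<lambda>m. inv g \<otimes> m \<otimes> g"]) (auto simp: m_assoc mult_inv_cancel_left)
  have "(\<Sum>m\<in>N. a (m \<otimes> (g \<otimes> x \<otimes> inv g))) = (\<Sum>m\<in>N. a ((g \<otimes> m \<otimes> inv g) \<otimes> (g \<otimes> x \<otimes> inv g)))"
    by (rule sum.reindex_bij_betw[OF bij, of "\<lambda>m. a (m \<otimes> (g \<otimes> x \<otimes> inv g))", symmetric])
  also have "\<dots> = (\<Sum>m\<in>N. a (m \<otimes> x))"
  proof (rule sum.cong[OF refl])
    fix m assume "m \<in> N"
    hence m: "m \<in> carrier G" by (rule mc)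
    have "(g \<otimes> m \<otimes> inv g) \<otimes> (g \<otimes> x \<otimes> inv g) = g \<otimes> (m \<otimes> x) \<otimes> inv g"
      using g x m by (simp add: m_assoc mult_inv_cancel_left)
    thus "a ((g \<otimes> m \<otimes> inv g) \<otimes> (g \<otimes> x \<otimes> inv g)) = a (m \<otimes> x)" using a g x m by simp
  qed
  finally show ?thesis .
qed

definition conj_class :: "'a \<Rightarrow> 'a set" where
  "conj_class g = (\<lambda>x. x \<otimes> g \<otimes> inv x) ` carrier G"

lemma conj_class_conj:
  assumes g: "g \<in> carrier G" and y: "y \<in> carrier G" and x: "x \<in> carrier G"
  shows "y \<otimes> x \<otimes> inv y \<in> conj_class g \<longleftrightarrow> x \<in> conj_class g"
proof
  assume "y \<otimes> x \<otimes> inv y \<in> conj_class g"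
  then obtain z where z: "z \<in> carrier G" "y \<otimes> x \<otimes> inv y = z \<otimes> g \<otimes> inv z" by (auto simp: conj_class_def)
  have "x = inv y \<otimes> (y \<otimes> x \<otimes> inv y) \<otimes> y" using x y by (simp add: m_assoc mult_inv_cancel_left)
  also have "\<dots> = (inv y \<otimes> z) \<otimes> g \<otimes> inv (inv y \<otimes> z)"
    using z x y g by (simp add: m_assoc inv_mult_group)
  finally show "x \<in> conj_class g" using z y unfolding conj_class_def by blast
next
  assume "x \<in> conj_class g"
  then obtain z where z: "z \<in> carrier G" "x = z \<otimes> g \<otimes> inv z" by (auto simp: conj_class_def)
  have "y \<otimes> x \<otimes> inv y = (y \<otimes> z) \<otimes> g \<otimes> inv (y \<otimes> z)"
    using z y g by (simp add: m_assoc inv_mult_group)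
  thus "y \<otimes> x \<otimes> inv y \<in> conj_class g" using z y unfolding conj_class_def by blast
qed

lemma conj_class_carrier: "g \<in> carrier G \<Longrightarrow> conj_class g \<subseteq> carrier G"
  by (auto simp: conj_class_def)

lemma self_in_conj_class: "g \<in> carrier G \<Longrightarrow> g \<in> conj_class g"
  unfolding conj_class_def by (auto intro!: image_eqI[of _ _ \<one>])

lemma commutators_with_conj_class:
  assumes "g \<in> carrier G" "m \<in> carrier G"
  shows "m \<in> commutators_with G g \<longleftrightarrow> m \<otimes> g \<in> conj_class g"
proof -
  have "m = x \<otimes> g \<otimes> inv x \<otimes> inv g \<longleftrightarrow> m \<otimes> g = x \<otimes> g \<otimes> inv x" if "x \<in> carrier G" for x
    using assms that inv_solve_right[of m "x \<otimes> g \<otimes> inv x" g] by auto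
  thus ?thesis unfolding commutators_with_def conj_class_def by (auto simp: image_iff)
qed

lemma sum_conj_class_Irr:
  assumes \<chi>: "\<chi> \<in> Irr G" and g: "g \<in> carrier G"
  shows "(\<Sum>x\<in>carrier G. (if x \<in> conj_class g then 1 else 0) * \<chi> x) = of_nat (card (conj_class g)) * \<chi> g"
proof -
  have "(\<Sum>x\<in>carrier G. (if x \<in> conj_class g then 1 else 0) * \<chi> x) = (\<Sum>x\<in>conj_class g. \<chi> x)"
    by (rule sum_indicator_times[OF finite_carrier conj_class_carrier[OF g]])
  also have "\<dots> = (\<Sum>x\<in>conj_class g. \<chi> g)"
    using Irr_conj[OF is_group \<chi> _ g] by (intro sum.cong refl) (auto simp: conj_class_def)
  finally show ?thesis by simp
qed

text \<open>Let \<open>a\<close> be the indicator function of the class of \<open>g\<close>. If all characters in \<open>Irr(G | N)\<close>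
  vanish at \<open>g\<close>, then the class function \<open>x \<mapsto> |N| a(x) - \<Sum>\<^sub>m a(m x)\<close>, with \<open>m\<close> running over \<open>N\<close>, is
  orthogonal to \<open>Irr(G)\<close>: to the characters with \<open>N\<close> in the kernel because its two terms cancel,
  to the others because both terms give zero. So it is zero, and its value at \<open>g\<close> shows that all of
  \<open>N g\<close> is conjugate to \<open>g\<close>. Conversely, if \<open>N g\<close> is contained in the class of \<open>g\<close>, then \<open>\<chi>\<close> is
  constant on \<open>N g\<close>, whereas it sums to zero there.\<close>

lemma Irr_rel_vanish_iff:
  assumes N: "N \<lhd> G" and g: "g \<in> carrier G"
  shows "(\<forall>\<chi>\<in>Irr_rel G N. \<chi> g = 0) \<longleftrightarrow> N \<subseteq> commutators_with G g"
proof
  interpret N: normal N G by fact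
  have Nc: "N \<subseteq> carrier G" by (rule N.subset)
  have fN: "finite N" using Nc finite_carrier finite_subset by blast
  assume van: "\<forall>\<chi>\<in>Irr_rel G N. \<chi> g = 0"
  define a :: "'a \<Rightarrow> complex" where "a x = (if x \<in> conj_class g then 1 else 0)" for x
  have a: "a (y \<otimes> x \<otimes> inv y) = a x" if "y \<in> carrier G" "x \<in> carrier G" for y x
    using conj_class_conj[OF g that] by (simp add: a_def)
  define f where "f x = of_nat (card N) * a x - (\<Sum>m\<in>N. a (m \<otimes> x))" for x
  have "f g = 0"
  proof (rule class_function_orthogonal_to_Irr_zero[OF is_group finite_carrier _ _ g])
    fix y x assume "y \<in> carrier G" "x \<in> carrier G"
    thus "f (y \<otimes> x \<otimes> inv y) = f x"
      using translate_class_function[OF N, of a] a by (simp add: f_def)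
  next
    fix \<chi> assume \<chi>: "\<chi> \<in> Irr G"
    have ag: "(\<Sum>x\<in>carrier G. a x * \<chi> x) = of_nat (card (conj_class g)) * \<chi> g"
      using sum_conj_class_Irr[OF \<chi> g] by (simp add: a_def)
    have "(\<Sum>x\<in>carrier G. f x * \<chi> x) =
        of_nat (card N) * (\<Sum>x\<in>carrier G. a x * \<chi> x) - (\<Sum>x\<in>carrier G. (\<Sum>m\<in>N. a (m \<otimes> x)) * \<chi> x)"
      by (simp add: f_def left_diff_distrib sum_subtractf sum_distrib_left mult.assoc)
    also have "\<dots> = 0"
      using van \<chi> by (auto simp: sum_translate_Irr[OF \<chi> N] ag Irr_rel_def)
    finally show "(\<Sum>x\<in>carrier G. f x * \<chi> x) = 0" .
  qed
  moreover have "(\<Sum>m\<in>N. a (m \<otimes> g)) = of_nat (card {m \<in> N. m \<otimes> g \<in> conj_class g})"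
    using fN by (simp add: a_def sum.If_cases Int_def)
  ultimately have "card {m \<in> N. m \<otimes> g \<in> conj_class g} = card N"
    using self_in_conj_class[OF g] by (simp add: f_def a_def)
  hence "{m \<in> N. m \<otimes> g \<in> conj_class g} = N"
    using fN by (intro card_subset_eq) auto
  thus "N \<subseteq> commutators_with G g"
    using commutators_with_conj_class[OF g] Nc by blast
next
  interpret N: normal N G by fact
  assume sub: "N \<subseteq> commutators_with G g"
  show "\<forall>\<chi>\<in>Irr_rel G N. \<chi> g = 0"
  proof
    fix \<chi> assume "\<chi> \<in> Irr_rel G N"
    hence \<chi>: "\<chi> \<in> Irr G" and nk: "\<not> N \<subseteq> char_ker G \<chi>" by (auto simp: Irr_rel_def)
    have "\<chi> (m \<otimes> g) = \<chi> g" if m: "m \<in> N" for m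
    proof -
      have "m \<otimes> g \<in> conj_class g"
        using commutators_with_conj_class[OF g, of m] m sub N.subset by blast
      thus ?thesis using Irr_conj[OF is_group \<chi> _ g] by (auto simp: conj_class_def)
    qed
    hence "of_nat (card N) * \<chi> g = (\<Sum>m\<in>N. \<chi> (m \<otimes> g))" by simp
    also have "\<dots> = 0" using Irr_sum_normal_coset[OF \<chi> N g] nk by simp
    finally have "of_nat (card N) * \<chi> g = 0" .
    moreover have "card N \<noteq> 0"
      using finite_subset[OF N.subset finite_carrier] N.one_closed by (metis card_eq_0_iff empty_iff)
    ultimately show "\<chi> g = 0" by simp
  qed
qed

text \<open>If no irreducible character with \<open>N\<close> in its kernel distinguished \<open>g\<close> from \<open>1\<close>, then the
  difference between the multiple \<open>|C|\<close> of the indicator function of \<open>1\<close> and the indicator function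
  of the class \<open>C\<close> of \<open>g\<close>, summed over the cosets of \<open>N\<close>, would be orthogonal to all irreducible
  characters; but its value at \<open>1\<close> is \<open>|C|\<close>, as \<open>C\<close> does not meet \<open>N\<close>.\<close>

lemma Irr_separates_from_normal:
  assumes N: "N \<lhd> G" and g: "g \<in> carrier G" "g \<notin> N"
  shows "\<exists>\<chi>\<in>Irr G. N \<subseteq> char_ker G \<chi> \<and> g \<notin> char_ker G \<chi>"
proof (rule ccontr)
  interpret N: normal N G by fact
  assume "\<not> ?thesis"
  hence all: "\<chi> g = \<chi> \<one>" if "\<chi> \<in> Irr G" "N \<subseteq> char_ker G \<chi>" for \<chi>
    using that by (auto simp: char_ker_def)
  define C where "C = conj_class g"
  define a :: "'a \<Rightarrow> complex"
    where "a x = of_nat (card C) * (if x \<in> conj_class \<one> then 1 else 0) - (if x \<in> C then 1 else 0)" for x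
  have c1: "conj_class \<one> = {\<one>}" by (auto simp: conj_class_def intro!: image_eqI[of _ _ \<one>])
  have fC: "finite C" using conj_class_carrier[OF g(1)] finite_carrier finite_subset by (auto simp: C_def)
  have a: "a (y \<otimes> x \<otimes> inv y) = a x" if "y \<in> carrier G" "x \<in> carrier G" for y x
    using conj_class_conj[OF g(1) that] conj_class_conj[OF one_closed that] by (simp add: a_def C_def)
  have "(\<Sum>m\<in>N. a (m \<otimes> \<one>)) = 0"
  proof (rule class_function_orthogonal_to_Irr_zero[OF is_group finite_carrier _ _ one_closed])
    fix \<chi> assume \<chi>: "\<chi> \<in> Irr G"
    have "(\<Sum>x\<in>carrier G. a x * \<chi> x) =
        of_nat (card C) * (\<Sum>x\<in>carrier G. (if x \<in> conj_class \<one> then 1 else 0) * \<chi> x) -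
        (\<Sum>x\<in>carrier G. (if x \<in> conj_class g then 1 else 0) * \<chi> x)"
      unfolding a_def C_def by (simp only: left_diff_distrib sum_subtractf sum_distrib_left mult.assoc)
    also have "\<dots> = of_nat (card C) * (\<chi> \<one> - \<chi> g)"
      unfolding sum_conj_class_Irr[OF \<chi> g(1)] sum_conj_class_Irr[OF \<chi> one_closed]
      by (simp add: c1 C_def right_diff_distrib)
    finally show "(\<Sum>x\<in>carrier G. (\<Sum>m\<in>N. a (m \<otimes> x)) * \<chi> x) = 0"
      using all[OF \<chi>] by (simp add: sum_translate_Irr[OF \<chi> N])
  qed (rule translate_class_function[OF N a])
  moreover have "a (m \<otimes> \<one>) = (if m = \<one> then of_nat (card C) else 0)" if m: "m \<in> N" for m
  proof -
    have "m \<notin> C"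
    proof
      assume "m \<in> C"
      then obtain x where x: "x \<in> carrier G" "m = x \<otimes> g \<otimes> inv x" by (auto simp: C_def conj_class_def)
      have "inv x \<otimes> m \<otimes> x \<in> N" using N.inv_op_closed1[OF x(1) m] .
      thus False using x g by (simp add: m_assoc mult_inv_cancel_left)
    qed
    thus ?thesis using m N.subset by (auto simp: a_def c1)
  qed
  ultimately have "(\<Sum>m\<in>N. if m = \<one> then of_nat (card C) else 0 :: complex) = 0"
    by simp
  hence "card C = 0"
    using finite_subset[OF N.subset finite_carrier] by simp
  thus False using fC self_in_conj_class[OF g(1)] by (auto simp: C_def)
qed

text \<open>Otherwise every irreducible character would sum to zero over \<open>G\<close>, so that the constant function
  \<open>1\<close> would be orthogonal to all of them.\<close>

lemma principal_character_exists: "\<exists>\<chi>\<in>Irr G. carrier G \<subseteq> char_ker G \<chi>"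
proof (rule ccontr)
  assume "\<not> ?thesis"
  hence "(\<Sum>x\<in>carrier G. 1 * \<chi> x) = 0" if "\<chi> \<in> Irr G" for \<chi>
    using that Irr_sum_normal_coset[OF that normal_self one_closed] by auto
  hence "(1::complex) = 0"
    by (intro class_function_orthogonal_to_Irr_zero[OF is_group finite_carrier, where f = "\<lambda>_. 1"]) auto
  thus False by simp
qed

end

section \<open>Commutator subgroups and the group center\<close>

lemma (in group) one_in_commutators_with: "g \<in> carrier G \<Longrightarrow> \<one> \<in> commutators_with G g"
  unfolding commutators_with_def by (auto intro!: image_eqI[of _ _ \<one>])

lemma (in group) commutators_with_carrier: "g \<in> carrier G \<Longrightarrow> commutators_with G g \<subseteq> carrier G"
  by (auto simp: commutators_with_def)

lemma commutator_subgroup_eq_generate: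
  "commutator_subgroup G (carrier G) A = generate G (\<Union>a\<in>A. commutators_with G a)"
  unfolding commutator_subgroup_def commutators_with_def by (rule arg_cong[of _ _ "generate G"]) auto

lemma (in group) commutators_with_subset_commutator_subgroup:
  "a \<in> A \<Longrightarrow> commutators_with G a \<subseteq> commutator_subgroup G (carrier G) A"
  unfolding commutator_subgroup_eq_generate by (auto intro: generate.incl)

lemma (in group) commutator_subgroup_least:
  assumes "subgroup K G" "\<And>a. a \<in> A \<Longrightarrow> commutators_with G a \<subseteq> K"
  shows "commutator_subgroup G (carrier G) A \<subseteq> K"
  unfolding commutator_subgroup_eq_generate by (rule generate_subgroup_incl) (use assms in auto)

lemma (in group) commutator_subgroup_normal:
  assumes A: "A \<subseteq> carrier G"
  shows "commutator_subgroup G (carrier G) A \<lhd> G"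
proof -
  let ?C = "\<Union>a\<in>A. commutators_with G a"
  have C: "?C \<subseteq> carrier G" using A commutators_with_carrier by blast
  have "y \<otimes> c \<otimes> inv y \<in> generate G ?C" if y: "y \<in> carrier G" and c: "c \<in> ?C" for y c
  proof -
    obtain a x where ax: "a \<in> A" "x \<in> carrier G" "c = x \<otimes> a \<otimes> inv x \<otimes> inv a"
      using c by (auto simp: commutators_with_def)
    have a: "a \<in> carrier G" using ax A by blast
    \<comment> \<open>This is \<open>y [x, a] y\<^sup>-\<^sup>1 = [y x, a] [y, a]\<^sup>-\<^sup>1\<close>.\<close>
    have "y \<otimes> c \<otimes> inv y =
        ((y \<otimes> x) \<otimes> a \<otimes> inv (y \<otimes> x) \<otimes> inv a) \<otimes> inv (y \<otimes> a \<otimes> inv y \<otimes> inv a)"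
      using y a ax by (simp add: m_assoc inv_mult_group mult_inv_cancel_left)
    moreover have "(y \<otimes> x) \<otimes> a \<otimes> inv (y \<otimes> x) \<otimes> inv a \<in> ?C" "y \<otimes> a \<otimes> inv y \<otimes> inv a \<in> ?C"
      using ax y by (auto simp: commutators_with_def)
    ultimately show ?thesis using generate.incl generate.inv generate.eng by metis
  qed
  moreover have "y \<otimes> h \<otimes> inv y \<in> generate G ?C" if y: "y \<in> carrier G" and h: "h \<in> generate G ?C"
    and gen: "\<And>c. c \<in> ?C \<Longrightarrow> y \<otimes> c \<otimes> inv y \<in> generate G ?C" for y h
    using h
  proof (induction h rule: generate.induct)
    case one
    then show ?case using y generate.one by simp
  next
    case (incl h)
    then show ?case by (rule gen)
  next
    case (inv h)
    hence "inv (y \<otimes> h \<otimes> inv y) = y \<otimes> inv h \<otimes> inv y"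
      using y C by (simp add: m_assoc inv_mult_group subset_iff)
    thus ?case using generate_m_inv_closed[OF C gen[OF inv]] by simp
  next
    case (eng h1 h2)
    have h: "h1 \<in> carrier G" "h2 \<in> carrier G" using eng generate_in_carrier[OF C] by auto
    have "y \<otimes> (h1 \<otimes> h2) \<otimes> inv y = (y \<otimes> h1 \<otimes> inv y) \<otimes> (y \<otimes> h2 \<otimes> inv y)"
      using h y by (simp add: m_assoc mult_inv_cancel_left)
    thus ?case using eng generate.eng by metis
  qed
  ultimately show ?thesis
    unfolding commutator_subgroup_eq_generate
    by (intro normal_invI generate_is_subgroup C) blast
qed

text \<open>In terms of the class of \<open>g\<close>: if \<open>K g\<close> is contained in the class, then so is its conjugate
  \<open>K g\<^sup>x\<close>, because \<open>K\<close> is normal. With \<open>c = [x, g]\<close> the element \<open>l c g\<close> lies in \<open>K g\<^sup>x\<close>.\<close>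

lemma (in group) absorb_commutators:
  assumes K: "K \<lhd> G" and sub: "K \<subseteq> commutators_with G g" and g: "g \<in> carrier G"
    and l: "l \<in> K" and c: "c \<in> commutators_with G g"
  shows "l \<otimes> c \<in> commutators_with G g"
proof -
  interpret K: normal K G by fact
  have lc: "l \<in> carrier G" using l K.subset by blast
  obtain x where x: "x \<in> carrier G" "c = x \<otimes> g \<otimes> inv x \<otimes> inv g"
    using c by (auto simp: commutators_with_def)
  have "inv x \<otimes> l \<otimes> x \<in> K" using K.inv_op_closed1[OF x(1) l] .
  then obtain y where y: "y \<in> carrier G" "inv x \<otimes> l \<otimes> x = y \<otimes> g \<otimes> inv y \<otimes> inv g"
    using sub by (auto simp: commutators_with_def)
  have "l \<otimes> c = x \<otimes> (inv x \<otimes> l \<otimes> x) \<otimes> g \<otimes> inv x \<otimes> inv g"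
    using x g lc by (simp add: m_assoc mult_inv_cancel_left)
  also have "\<dots> = (x \<otimes> y) \<otimes> g \<otimes> inv (x \<otimes> y) \<otimes> inv g"
    unfolding y(2) using x y g by (simp add: m_assoc inv_mult_group mult_inv_cancel_left)
  finally show ?thesis using x y by (auto simp: commutators_with_def)
qed

lemma (in group) group_center_commute:
  "z \<in> group_center G \<Longrightarrow> g \<in> carrier G \<Longrightarrow> z \<otimes> g = g \<otimes> z"
  unfolding group_center_def by blast

lemma (in group) group_center_subgroup: "subgroup (group_center G) G"
proof (rule subgroupI)
  show "group_center G \<noteq> {}" by (auto simp: group_center_def intro: exI[of _ \<one>])
  fix a assume a: "a \<in> group_center G"
  hence ac: "a \<in> carrier G" by (simp add: group_center_def)
  have "inv a \<otimes> g = g \<otimes> inv a" if g: "g \<in> carrier G" for g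
  proof -
    have "inv a \<otimes> g = inv a \<otimes> (g \<otimes> a) \<otimes> inv a" using ac g by (simp add: m_assoc)
    also have "g \<otimes> a = a \<otimes> g" using group_center_commute[OF a g] by (rule sym)
    also have "inv a \<otimes> (a \<otimes> g) \<otimes> inv a = g \<otimes> inv a" using ac g by (simp add: mult_inv_cancel_left)
    finally show ?thesis .
  qed
  thus "inv a \<in> group_center G" using ac unfolding group_center_def by blast
next
  fix a b assume ab: "a \<in> group_center G" "b \<in> group_center G"
  hence ac: "a \<in> carrier G" and bc: "b \<in> carrier G" by (auto simp: group_center_def)
  have "a \<otimes> b \<otimes> g = g \<otimes> (a \<otimes> b)" if g: "g \<in> carrier G" for g
  proof -
    have "a \<otimes> b \<otimes> g = a \<otimes> (b \<otimes> g)" using ac bc g by (rule m_assoc)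
    also have "b \<otimes> g = g \<otimes> b" by (rule group_center_commute[OF ab(2) g])
    also have "a \<otimes> (g \<otimes> b) = (a \<otimes> g) \<otimes> b" using ac bc g by (simp add: m_assoc)
    also have "a \<otimes> g = g \<otimes> a" by (rule group_center_commute[OF ab(1) g])
    finally show ?thesis using ac bc g by (simp add: m_assoc)
  qed
  thus "a \<otimes> b \<in> group_center G" using ac bc unfolding group_center_def by blast
qed (auto simp: group_center_def)

section \<open>The subgroup \<open>U(G | N)\<close> and its pullback from a quotient\<close>

context finite_group
begin

lemma V_rel_subset_iff:
  assumes H: "H \<lhd> G" and N: "subgroup N G"
  shows "V_rel G H \<subseteq> N \<longleftrightarrow> (\<forall>g\<in>carrier G - N. H \<subseteq> commutators_with G g)"
proof -
  let ?S = "{g \<in> carrier G. \<exists>\<chi>\<in>Irr_rel G H. \<chi> g \<noteq> 0}"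
  have "V_rel G H \<subseteq> N \<longleftrightarrow> ?S \<subseteq> N"
    unfolding V_rel_def using generate_subgroup_incl[OF _ N] generate.incl[of _ ?S G] by blast
  also have "\<dots> \<longleftrightarrow> (\<forall>g\<in>carrier G - N. \<forall>\<chi>\<in>Irr_rel G H. \<chi> g = 0)" by blast
  finally show ?thesis using Irr_rel_vanish_iff[OF H] by simp
qed

lemma U_rel_normal: "U_rel G N \<lhd> G"
  unfolding U_rel_def
proof (rule normal_generateI)
  show "\<Union> {H. H \<lhd> G \<and> V_rel G H \<subseteq> N} \<subseteq> carrier G"
    using normal_imp_subgroup subgroup.subset by blast
  fix h g assume "h \<in> \<Union> {H. H \<lhd> G \<and> V_rel G H \<subseteq> N}" "g \<in> carrier G"
  thus "g \<otimes> h \<otimes> inv g \<in> \<Union> {H. H \<lhd> G \<and> V_rel G H \<subseteq> N}"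
    using normal.inv_op_closed2 by fastforce
qed

text \<open>The defining property of the factors is inherited by their product: a character whose kernel
  does not contain the product does not contain one of the factors in its kernel either.\<close>

lemma U_rel_subset_commutators_with:
  assumes N: "subgroup N G" and g: "g \<in> carrier G" "g \<notin> N"
  shows "U_rel G N \<subseteq> commutators_with G g"
proof -
  have "\<chi> g = 0" if \<chi>: "\<chi> \<in> Irr_rel G (U_rel G N)" for \<chi>
  proof -
    have irr: "\<chi> \<in> Irr G" and n: "\<not> U_rel G N \<subseteq> char_ker G \<chi>" using \<chi> by (auto simp: Irr_rel_def)
    have "subgroup (char_ker G \<chi>) G" using Irr_ker_normal[OF irr] by (rule normal_imp_subgroup)
    hence "\<not> \<Union> {H. H \<lhd> G \<and> V_rel G H \<subseteq> N} \<subseteq> char_ker G \<chi>"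
      using n generate_subgroup_incl unfolding U_rel_def by blast
    then obtain H where H: "H \<lhd> G" "V_rel G H \<subseteq> N" "\<not> H \<subseteq> char_ker G \<chi>" by blast
    hence "\<chi> \<in> Irr_rel G H" using irr by (simp add: Irr_rel_def)
    thus ?thesis
      using H g V_rel_subset_iff[OF H(1) N] Irr_rel_vanish_iff[OF H(1) g(1)] by blast
  qed
  thus ?thesis using Irr_rel_vanish_iff[OF U_rel_normal g(1)] by blast
qed

lemma subset_U_rel:
  assumes N: "subgroup N G" and H: "H \<lhd> G"
    and "\<And>g. g \<in> carrier G \<Longrightarrow> g \<notin> N \<Longrightarrow> H \<subseteq> commutators_with G g"
  shows "H \<subseteq> U_rel G N"
proof -
  have "V_rel G H \<subseteq> N" using V_rel_subset_iff[OF H N] assms(3) by blast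
  thus ?thesis using H generate.incl[of _ "\<Union> {H. H \<lhd> G \<and> V_rel G H \<subseteq> N}" G]
    unfolding U_rel_def by blast
qed

text \<open>The step from one member of the upsilon series to the next.\<close>

definition U_preimage :: "'a set \<Rightarrow> 'a set" where
  "U_preimage K = {g \<in> carrier G. K #> g \<in> U_group (G Mod K)}"

end

locale finite_group_normal = finite_group + normal K G for K
begin

abbreviation "Q \<equiv> G Mod K"
abbreviation "\<pi> g \<equiv> K #> g"

sublocale Q: finite_group Q
proof (intro finite_group.intro finite_group_axioms.intro)
  show "group Q" by (rule factorgroup_is_group)
  show "finite (carrier Q)" using finite_carrier by (simp add: carrier_FactGroup)
qed

sublocale \<pi>: group_hom G Q "\<lambda>g. K #> g"
  using r_coset_hom_Mod by unfold_locales

lemma pi_eq_iff: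
  assumes "a \<in> carrier G" "b \<in> carrier G"
  shows "\<pi> a = \<pi> b \<longleftrightarrow> a \<otimes> inv b \<in> K"
proof
  assume "\<pi> a = \<pi> b"
  hence "a \<in> \<pi> b" using rcos_self[OF assms(1) is_subgroup] by simp
  then obtain k where "k \<in> K" "a = k \<otimes> b" by (auto simp: r_coset_def)
  thus "a \<otimes> inv b \<in> K" using assms subset by (simp add: m_assoc subset_iff)
next
  assume k: "a \<otimes> inv b \<in> K"
  have "a = (a \<otimes> inv b) \<otimes> b" using assms by (simp add: m_assoc)
  hence "a \<in> \<pi> b" using k unfolding r_coset_def by blast
  thus "\<pi> a = \<pi> b" using repr_independence[OF _ assms(2) is_subgroup] by simp
qed

lemma pi_commutators_with:
  assumes g: "g \<in> carrier G"
  shows "commutators_with Q (\<pi> g) = \<pi> ` commutators_with G g"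
proof -
  have "\<pi> (x \<otimes> g \<otimes> inv x \<otimes> inv g) =
      \<pi> x \<otimes>\<^bsub>Q\<^esub> \<pi> g \<otimes>\<^bsub>Q\<^esub> inv\<^bsub>Q\<^esub> (\<pi> x) \<otimes>\<^bsub>Q\<^esub> inv\<^bsub>Q\<^esub> (\<pi> g)" if "x \<in> carrier G" for x
    using that g by (simp del: mult_FactGroup)
  thus ?thesis
    unfolding commutators_with_def carrier_FactGroup image_image
    by (intro image_cong refl) simp
qed

lemma pi_center_iff:
  assumes g: "g \<in> carrier G"
  shows "\<pi> g \<in> group_center Q \<longleftrightarrow> commutators_with G g \<subseteq> K"
proof -
  have "\<pi> g \<otimes>\<^bsub>Q\<^esub> \<pi> x = \<pi> x \<otimes>\<^bsub>Q\<^esub> \<pi> g \<longleftrightarrow> x \<otimes> g \<otimes> inv x \<otimes> inv g \<in> K" if x: "x \<in> carrier G" for x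
  proof -
    have "\<pi> g \<otimes>\<^bsub>Q\<^esub> \<pi> x = \<pi> x \<otimes>\<^bsub>Q\<^esub> \<pi> g \<longleftrightarrow> \<pi> (x \<otimes> g) = \<pi> (g \<otimes> x)"
      using x g by (auto simp only: \<pi>.hom_mult)
    also have "\<dots> \<longleftrightarrow> x \<otimes> g \<otimes> inv (g \<otimes> x) \<in> K" using x g by (intro pi_eq_iff) auto
    also have "x \<otimes> g \<otimes> inv (g \<otimes> x) = x \<otimes> g \<otimes> inv x \<otimes> inv g"
      using x g by (simp add: m_assoc inv_mult_group)
    finally show ?thesis .
  qed
  thus ?thesis
    using g by (auto simp: group_center_def carrier_FactGroup commutators_with_def)
qed

lemma preimage_subgroup:
  assumes "subgroup L Q"
  shows "subgroup {g \<in> carrier G. \<pi> g \<in> L} G"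
proof -
  interpret L: subgroup L Q by fact
  show ?thesis
  proof (rule subgroupI)
    show "{g \<in> carrier G. \<pi> g \<in> L} \<noteq> {}"
      using \<pi>.hom_one L.one_closed by (auto intro!: exI[of _ \<one>] simp del: one_FactGroup)
  next
    fix a assume "a \<in> {g \<in> carrier G. \<pi> g \<in> L}"
    thus "inv a \<in> {g \<in> carrier G. \<pi> g \<in> L}" using L.m_inv_closed[of "\<pi> a"] \<pi>.hom_inv[of a] by auto
  next
    fix a b assume "a \<in> {g \<in> carrier G. \<pi> g \<in> L}" "b \<in> {g \<in> carrier G. \<pi> g \<in> L}"
    thus "a \<otimes> b \<in> {g \<in> carrier G. \<pi> g \<in> L}"
      using L.m_closed[of "\<pi> a" "\<pi> b"] \<pi>.hom_mult[of a b] by auto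
  qed auto
qed

lemma preimage_normal:
  assumes L: "L \<lhd> Q"
  shows "{g \<in> carrier G. \<pi> g \<in> L} \<lhd> G"
proof (rule normal_invI)
  show "subgroup {g \<in> carrier G. \<pi> g \<in> L} G"
    using L by (intro preimage_subgroup normal_imp_subgroup)
  fix x h assume x: "x \<in> carrier G" and h: "h \<in> {g \<in> carrier G. \<pi> g \<in> L}"
  have "\<pi> (x \<otimes> h \<otimes> inv x) = \<pi> x \<otimes>\<^bsub>Q\<^esub> \<pi> h \<otimes>\<^bsub>Q\<^esub> inv\<^bsub>Q\<^esub> (\<pi> x)"
    using x h by (simp del: mult_FactGroup)
  moreover have "\<pi> x \<otimes>\<^bsub>Q\<^esub> \<pi> h \<otimes>\<^bsub>Q\<^esub> inv\<^bsub>Q\<^esub> (\<pi> x) \<in> L"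
    using normal.inv_op_closed2[OF L \<pi>.hom_closed[OF x]] h by simp
  ultimately show "x \<otimes> h \<otimes> inv x \<in> {g \<in> carrier G. \<pi> g \<in> L}" using x h by simp
qed

lemma U_preimage_normal: "U_preimage K \<lhd> G"
  unfolding U_preimage_def U_group_def by (rule preimage_normal[OF Q.U_rel_normal])

lemma subset_U_preimage: "K \<subseteq> U_preimage K"
proof
  fix k assume k: "k \<in> K"
  hence kc: "k \<in> carrier G" using subset by blast
  have "\<pi> k = \<one>\<^bsub>Q\<^esub>" using coset_join2[OF kc is_subgroup k] by simp
  moreover have "\<one>\<^bsub>Q\<^esub> \<in> U_group Q"
    unfolding U_group_def using normal_imp_subgroup[OF Q.U_rel_normal] subgroup.one_closed by blast
  ultimately show "k \<in> U_preimage K" using kc by (simp add: U_preimage_def)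
qed

text \<open>This lemma and the next describe the step in terms of commutators in \<open>G\<close> alone, so that the
  quotient and its characters need not be mentioned again.\<close>

lemma U_preimage_commutator:
  assumes g: "g \<in> carrier G" "\<not> commutators_with G g \<subseteq> K" and u: "u \<in> U_preimage K"
  shows "\<exists>l\<in>K. \<exists>c\<in>commutators_with G g. u = l \<otimes> c"
proof -
  have uc: "u \<in> carrier G" and uU: "\<pi> u \<in> U_rel Q (group_center Q)"
    using u by (auto simp: U_preimage_def U_group_def)
  have "U_rel Q (group_center Q) \<subseteq> commutators_with Q (\<pi> g)"
    using g pi_center_iff by (intro Q.U_rel_subset_commutators_with Q.group_center_subgroup) auto
  then obtain c where c: "c \<in> commutators_with G g" "\<pi> u = \<pi> c"
    using uU pi_commutators_with[OF g(1)] by auto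
  have cc: "c \<in> carrier G" using c commutators_with_carrier[OF g(1)] by blast
  have "u = (u \<otimes> inv c) \<otimes> c" using uc cc by (simp add: m_assoc)
  moreover have "u \<otimes> inv c \<in> K" using c pi_eq_iff[OF uc cc] by simp
  ultimately show ?thesis using c by blast
qed

lemma subset_U_preimageI:
  assumes H: "H \<lhd> G"
    and sub: "\<And>g. g \<in> carrier G \<Longrightarrow> \<not> commutators_with G g \<subseteq> K \<Longrightarrow> H \<subseteq> commutators_with G g"
  shows "H \<subseteq> U_preimage K"
proof -
  interpret H: normal H G by fact
  have "\<pi> ` H \<lhd> Q"
  proof (rule Q.normal_invI)
    show "subgroup (\<pi> ` H) Q" by (rule \<pi>.subgroup_img_is_subgroup[OF H.is_subgroup])
    fix X h assume "X \<in> carrier Q" "h \<in> \<pi> ` H"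
    then obtain x y where x: "x \<in> carrier G" "X = \<pi> x" and y: "y \<in> H" "h = \<pi> y"
      by (auto simp: carrier_FactGroup)
    have "X \<otimes>\<^bsub>Q\<^esub> h \<otimes>\<^bsub>Q\<^esub> inv\<^bsub>Q\<^esub> X = \<pi> (x \<otimes> y \<otimes> inv x)"
      unfolding x(2) y(2) using x y H.mem_carrier by (simp del: mult_FactGroup)
    thus "X \<otimes>\<^bsub>Q\<^esub> h \<otimes>\<^bsub>Q\<^esub> inv\<^bsub>Q\<^esub> X \<in> \<pi> ` H" using H.inv_op_closed2[OF x(1) y(1)] by blast
  qed
  moreover have "\<pi> ` H \<subseteq> commutators_with Q X" if X: "X \<in> carrier Q" "X \<notin> group_center Q" for X
  proof -
    obtain g where g: "g \<in> carrier G" "X = \<pi> g" using X by (auto simp: carrier_FactGroup)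
    thus ?thesis using X sub[OF g(1)] pi_center_iff[OF g(1)] pi_commutators_with[OF g(1)] by auto
  qed
  ultimately have "\<pi> ` H \<subseteq> U_group Q"
    unfolding U_group_def by (intro Q.subset_U_rel Q.group_center_subgroup)
  thus ?thesis using H.subset by (auto simp: U_preimage_def)
qed

end

section \<open>The upsilon series\<close>

context finite_group
begin

lemma upsilon_Suc_U_preimage: "upsilon G (Suc i) = U_preimage (upsilon G i)"
  by (simp add: U_preimage_def)

lemma upsilon_normal: "upsilon G i \<lhd> G"
proof (induction i)
  case 0
  show ?case using one_is_normal by simp
next
  case (Suc i)
  interpret finite_group_normal G "upsilon G i"
    using Suc finite_group_axioms by (simp add: finite_group_normal_def)
  show ?case unfolding upsilon_Suc_U_preimage by (rule U_preimage_normal)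
qed

lemma finite_group_normal_upsilon: "finite_group_normal G (upsilon G i)"
  using upsilon_normal finite_group_axioms by (simp add: finite_group_normal_def)

lemma upsilon_mono: "i \<le> j \<Longrightarrow> upsilon G i \<subseteq> upsilon G j"
  by (rule lift_Suc_mono_le[of "upsilon G"])
    (simp_all only: upsilon_Suc_U_preimage finite_group_normal.subset_U_preimage[OF finite_group_normal_upsilon])

lemma upsilon_inf_eq_carrier_iff: "upsilon_inf G = carrier G \<longleftrightarrow> (\<exists>m. upsilon G m = carrier G)"
proof -
  have sub: "upsilon G i \<subseteq> carrier G" for i
    using upsilon_normal normal_imp_subgroup subgroup.subset by blast
  have "card (upsilon G i) < Suc (card (carrier G))" for i
    using card_mono[OF finite_carrier sub, of i] by simp
  then obtain m where m: "\<And>i. card (upsilon G i) \<le> card (upsilon G m)"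
    using ex_has_greatest_nat[of "\<lambda>_. True" 0 "\<lambda>i. card (upsilon G i)"] by blast
  have stable: "upsilon G i = upsilon G m" if "m \<le> i" for i
    using card_seteq[OF finite_subset[OF sub finite_carrier] upsilon_mono[OF that] m] by simp
  have "upsilon_inf G = upsilon G m"
    unfolding upsilon_inf_def
  proof (rule the_equality)
    show "\<exists>k. \<forall>i\<ge>k. upsilon G i = upsilon G m" using stable by blast
    fix H assume "\<exists>k. \<forall>i\<ge>k. upsilon G i = H"
    then obtain k where "\<forall>i\<ge>k. upsilon G i = H" ..
    thus "H = upsilon G m" using stable[of "max k m"] by simp
  qed
  moreover have "upsilon G m = carrier G" if "upsilon G k = carrier G" for k
    using that upsilon_mono[of k "max k m"] stable[of "max k m"] sub[of m] by auto
  ultimately show ?thesis by auto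
qed

end

section \<open>Nested GVZ-groups\<close>

lemma finite_chain_enumeration:
  assumes "finite C" "C \<noteq> {}" "chain\<^sub>\<subseteq> C"
  shows "\<exists>n X. (\<forall>i<n. X (Suc i) \<subset> X i) \<and> X ` {..n} = (C :: 'a set set)"
  using assms
proof (induction "card C" arbitrary: C)
  case 0
  then show ?case by simp
next
  case (Suc k)
  define M where "M = \<Inter>C"
  have M: "M \<in> C"
    unfolding M_def using Suc.prems Inter_in_chain[of C UNIV] by (simp add: chain_subset_alt_def)
  show ?case
  proof (cases "C = {M}")
    case True
    thus ?thesis by (intro exI[of _ 0] exI[of _ "\<lambda>_. M"]) simp
  next
    case False
    have "\<exists>n X. (\<forall>i<n. X (Suc i) \<subset> X i) \<and> X ` {..n} = C - {M}"
      using Suc M False by (intro Suc.hyps(1)) (auto simp: chain_subset_def)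
    then obtain n X where X: "\<forall>i<n. X (Suc i) \<subset> X i" "X ` {..n} = C - {M}" by blast
    have "M \<subset> X n" using X(2) by (auto simp: M_def)
    hence "\<forall>i<Suc n. (X(Suc n := M)) (Suc i) \<subset> (X(Suc n := M)) i"
      using X(1) by (auto simp: less_Suc_eq)
    moreover have "(X(Suc n := M)) ` {..Suc n} = C"
    proof -
      have "(X(Suc n := M)) ` {..n} = C - {M}"
        unfolding X(2)[symmetric] by (intro image_cong) auto
      thus ?thesis using insert_Diff[OF M] by (simp only: atMost_Suc image_insert fun_upd_same)
    qed
    ultimately have "(\<forall>i<Suc n. (X(Suc n := M)) (Suc i) \<subset> (X(Suc n := M)) i) \<and> (X(Suc n := M)) ` {..Suc n} = C"
      by (rule conjI)
    thus ?thesis by (intro exI)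
  qed
qed

context finite_group
begin

text \<open>It is the preimage of the center of \<open>G / ker \<chi>\<close>.\<close>

lemma char_center_subgroup:
  assumes \<chi>: "\<chi> \<in> Irr G"
  shows "subgroup (char_center G \<chi>) G"
proof -
  interpret finite_group_normal G "char_ker G \<chi>"
    using Irr_ker_normal[OF \<chi>] finite_group_axioms by (simp add: finite_group_normal_def)
  have "char_center G \<chi> = {g \<in> carrier G. \<pi> g \<in> group_center Q}"
    using Irr_center_iff[OF \<chi>] pi_center_iff by blast
  thus ?thesis using preimage_subgroup[OF Q.group_center_subgroup] by simp
qed

text \<open>Since \<open>\<chi>\<close> does not vanish on \<open>Z(\<chi>)\<close>, the condition \<open>V(\<chi>) = Z(\<chi>)\<close> says that \<open>\<chi>\<close> vanishes off
  \<open>Z(\<chi>)\<close>. For fixed \<open>g\<close>, the characters with \<open>g \<notin> Z(\<chi>)\<close> are those in \<open>Irr(G | [G, g])\<close>, so the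
  vanishing criterion applies.\<close>

lemma GVZ_iff:
  "GVZ_group G \<longleftrightarrow> (\<forall>g\<in>carrier G. commutator_subgroup G (carrier G) {g} \<subseteq> commutators_with G g)"
proof -
  have V: "char_V G \<chi> = char_center G \<chi> \<longleftrightarrow> (\<forall>g\<in>carrier G - char_center G \<chi>. \<chi> g = 0)"
    if \<chi>: "\<chi> \<in> Irr G" for \<chi>
  proof
    assume "char_V G \<chi> = char_center G \<chi>"
    moreover have "{g \<in> carrier G. \<chi> g \<noteq> 0} \<subseteq> char_V G \<chi>"
      unfolding char_V_def by (rule subsetI) (rule generate.incl)
    ultimately show "\<forall>g\<in>carrier G - char_center G \<chi>. \<chi> g = 0" by auto
  next
    assume "\<forall>g\<in>carrier G - char_center G \<chi>. \<chi> g = 0"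
    moreover have "char_center G \<chi> \<subseteq> carrier G" by (auto simp: char_center_def)
    ultimately have "{g \<in> carrier G. \<chi> g \<noteq> 0} = char_center G \<chi>"
      using Irr_center_nonzero[OF \<chi>] by blast
    moreover have "generate G (char_center G \<chi>) = char_center G \<chi>"
      using generate_subgroup_incl[OF subset_refl char_center_subgroup[OF \<chi>]]
      by (intro equalityI subsetI) (auto intro: generate.incl)
    ultimately show "char_V G \<chi> = char_center G \<chi>" by (simp add: char_V_def)
  qed
  have "GVZ_group G \<longleftrightarrow> (\<forall>g\<in>carrier G. \<forall>\<chi>\<in>Irr_rel G (commutator_subgroup G (carrier G) {g}). \<chi> g = 0)"
  proof -
    have "g \<notin> char_center G \<chi> \<longleftrightarrow> \<not> commutator_subgroup G (carrier G) {g} \<subseteq> char_ker G \<chi>"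
      if g: "g \<in> carrier G" and \<chi>: "\<chi> \<in> Irr G" for g \<chi>
    proof -
      have "subgroup (char_ker G \<chi>) G" using Irr_ker_normal[OF \<chi>] by (rule normal_imp_subgroup)
      hence "commutators_with G g \<subseteq> char_ker G \<chi> \<longleftrightarrow> commutator_subgroup G (carrier G) {g} \<subseteq> char_ker G \<chi>"
        using commutator_subgroup_least[of "char_ker G \<chi>" "{g}"]
          commutators_with_subset_commutator_subgroup[of g "{g}"] by auto
      thus ?thesis using Irr_center_iff[OF \<chi>] g by simp
    qed
    moreover have "GVZ_group G \<longleftrightarrow> (\<forall>\<chi>\<in>Irr G. \<forall>g\<in>carrier G - char_center G \<chi>. \<chi> g = 0)"
      unfolding GVZ_group_def using V by simp
    ultimately show ?thesis unfolding Irr_rel_def by blast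
  qed
  thus ?thesis using Irr_rel_vanish_iff[OF commutator_subgroup_normal] by simp
qed

text \<open>For the least \<open>i\<close> with all \<open>[x, g]\<close> in \<open>\<upsilon>\<^sub>i\<close>, the element \<open>g\<close> is not central modulo any earlier
  member, so each step up to \<open>\<upsilon>\<^sub>i\<close> yields elements \<open>l [x, g]\<close> with \<open>l\<close> in the previous member, and
  these are again commutators with \<open>g\<close>.\<close>

lemma commutators_with_eq_upsilon:
  assumes top: "upsilon G m = carrier G" and g: "g \<in> carrier G"
  shows "\<exists>i. commutators_with G g = upsilon G i"
proof -
  define i where "i = (LEAST i. commutators_with G g \<subseteq> upsilon G i)"
  have "commutators_with G g \<subseteq> upsilon G m" using top commutators_with_carrier[OF g] by simp
  hence le: "commutators_with G g \<subseteq> upsilon G i" unfolding i_def by (rule LeastI)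
  have nle: "\<not> commutators_with G g \<subseteq> upsilon G j" if "j < i" for j
    using not_less_Least that unfolding i_def by blast
  have "upsilon G j \<subseteq> commutators_with G g" if "j \<le> i" for j
    using that
  proof (induction j)
    case 0
    show ?case using one_in_commutators_with[OF g] by simp
  next
    case (Suc j)
    interpret finite_group_normal G "upsilon G j" by (rule finite_group_normal_upsilon)
    have sub: "upsilon G j \<subseteq> commutators_with G g" using Suc by simp
    show ?case
    proof
      fix u assume "u \<in> upsilon G (Suc j)"
      then obtain l c where "l \<in> upsilon G j" "c \<in> commutators_with G g" "u = l \<otimes> c"
        using U_preimage_commutator[OF g nle[of j]] Suc.prems unfolding upsilon_Suc_U_preimage
        by (meson Suc_le_lessD)
      thus "u \<in> commutators_with G g" using absorb_commutators[OF upsilon_normal sub g] by simp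
    qed
  qed
  thus ?thesis using le by blast
qed

text \<open>If two centers \<open>Z(\<chi>)\<close> and \<open>Z(\<psi>)\<close> were incomparable, witnesses \<open>g\<close> and \<open>h\<close> would have
  incomparable sets of commutators.\<close>

lemma upsilon_top_imp_nested_GVZ:
  assumes top: "upsilon G m = carrier G"
  shows "nested_group G \<and> GVZ_group G"
proof
  show "GVZ_group G"
    unfolding GVZ_iff
  proof
    fix g assume g: "g \<in> carrier G"
    obtain i where i: "commutators_with G g = upsilon G i" using commutators_with_eq_upsilon[OF top g] ..
    show "commutator_subgroup G (carrier G) {g} \<subseteq> commutators_with G g"
      unfolding i by (rule commutator_subgroup_least[OF normal_imp_subgroup[OF upsilon_normal]]) (simp add: i)
  qed
  show "nested_group G"
    unfolding nested_group_def chain_subset_def char_centers_def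
  proof (intro ballI, elim imageE, rule ccontr)
    fix A B \<chi> \<psi> assume A: "A = char_center G \<chi>" "\<chi> \<in> Irr G" and B: "B = char_center G \<psi>" "\<psi> \<in> Irr G"
    assume "\<not> (A \<subseteq> B \<or> B \<subseteq> A)"
    then obtain g h where "g \<in> A" "g \<notin> B" "h \<in> B" "h \<notin> A" by blast
    hence gh: "g \<in> carrier G" "h \<in> carrier G"
      "commutators_with G g \<subseteq> char_ker G \<chi>" "\<not> commutators_with G g \<subseteq> char_ker G \<psi>"
      "commutators_with G h \<subseteq> char_ker G \<psi>" "\<not> commutators_with G h \<subseteq> char_ker G \<chi>"
      using Irr_center_iff A B by auto
    obtain i j where "commutators_with G g = upsilon G i" "commutators_with G h = upsilon G j"
      using commutators_with_eq_upsilon[OF top gh(1)] commutators_with_eq_upsilon[OF top gh(2)] by blast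
    thus False using gh(3-6) upsilon_mono[of i j] upsilon_mono[of j i] by (cases "i \<le> j") auto
  qed
qed

lemma chain_of_centers_exists:
  assumes "nested_group G"
  shows "\<exists>n X. chain_of_centers G n X"
proof -
  have sub: "char_centers G \<subseteq> Pow (carrier G)" by (auto simp: char_centers_def char_center_def)
  obtain \<chi> where \<chi>: "\<chi> \<in> Irr G" "carrier G \<subseteq> char_ker G \<chi>" using principal_character_exists by blast
  have "char_center G \<chi> = carrier G"
    using Irr_center_iff[OF \<chi>(1)] \<chi>(2) commutators_with_carrier by blast
  hence G: "carrier G \<in> char_centers G" using \<chi>(1) unfolding char_centers_def by blast
  have "finite (char_centers G)" using sub finite_carrier by (simp add: finite_subset)
  then obtain n X where X: "\<forall>i<n. X (Suc i) \<subset> X i" "X ` {..n} = char_centers G"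
    using finite_chain_enumeration[of "char_centers G"] G assms unfolding nested_group_def by blast
  obtain k where k: "k \<le> n" "X k = carrier G" using G X(2) by (metis atMost_iff imageE)
  have "X k \<subseteq> X 0" using k(1)
  proof (induction k)
    case (Suc k)
    thus ?case using X(1) by (metis Suc_le_eq dual_order.trans less_imp_le psubset_imp_subset)
  qed simp
  moreover have "X 0 \<subseteq> carrier G" using X(2) sub by auto
  ultimately have "X 0 = carrier G" using k by simp
  thus ?thesis using X unfolding chain_of_centers_def by blast
qed

context
  fixes n X
  assumes GVZ: "GVZ_group G" and chain: "chain_of_centers G n X"
begin

lemma chain_antimono: "i \<le> j \<Longrightarrow> j \<le> n \<Longrightarrow> X j \<subseteq> X i"
proof (induction j)
  case (Suc j)
  have "X (Suc j) \<subseteq> X j" using chain Suc.prems unfolding chain_of_centers_def by (simp add: psubset_imp_subset)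
  thus ?case using Suc by (cases "i = Suc j") auto
qed simp

lemma chain_member_center:
  assumes "i \<le> n"
  obtains \<chi> where "\<chi> \<in> Irr G" "X i = char_center G \<chi>"
proof -
  have "X i \<in> char_center G ` Irr G"
    using assms chain unfolding chain_of_centers_def char_centers_def by blast
  thus ?thesis using that by auto
qed

lemma center_chain_member:
  assumes "\<chi> \<in> Irr G"
  obtains i where "i \<le> n" "X i = char_center G \<chi>"
proof -
  have "char_center G \<chi> \<in> X ` {..n}"
    using assms chain by (simp add: chain_of_centers_def char_centers_def)
  thus ?thesis using that by auto
qed

lemma chain_member_carrier:
  assumes "i \<le> n"
  shows "X i \<subseteq> carrier G"
proof -
  obtain \<chi> where "X i = char_center G \<chi>" using assms by (rule chain_member_center)
  thus ?thesis by (auto simp: char_center_def)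
qed

text \<open>Each member of the chain is \<open>Z(\<chi>)\<close> for some \<open>\<chi>\<close>, and \<open>[G, Z(\<chi>)] \<subseteq> ker \<chi>\<close>. So an element that is
  central modulo \<open>[G, Z(\<chi>)]\<close> is central modulo \<open>ker \<chi>\<close>.\<close>

lemma chain_member_iff:
  assumes i: "i \<le> n" and g: "g \<in> carrier G"
  shows "g \<in> X i \<longleftrightarrow> commutators_with G g \<subseteq> commutator_subgroup G (carrier G) (X i)"
proof
  obtain \<chi> where \<chi>: "\<chi> \<in> Irr G" "X i = char_center G \<chi>" using i by (rule chain_member_center)
  have "commutator_subgroup G (carrier G) (X i) \<subseteq> char_ker G \<chi>"
    using Irr_center_iff[OF \<chi>(1)] \<chi>(2)
    by (intro commutator_subgroup_least normal_imp_subgroup Irr_ker_normal \<chi>(1)) auto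
  moreover assume "commutators_with G g \<subseteq> commutator_subgroup G (carrier G) (X i)"
  ultimately show "g \<in> X i" using Irr_center_iff[OF \<chi>(1)] \<chi>(2) g by blast
qed (rule commutators_with_subset_commutator_subgroup)

text \<open>The last member is contained in \<open>Z(\<chi>)\<close> for all \<open>\<chi>\<close>, so its commutators lie in the intersection
  of all kernels, which is trivial.\<close>

lemma commutator_subgroup_last: "commutator_subgroup G (carrier G) (X n) = {\<one>}"
proof -
  have "commutators_with G g \<subseteq> {\<one>}" if g: "g \<in> X n" for g
  proof
    fix c assume c: "c \<in> commutators_with G g"
    have gc: "g \<in> carrier G" using g chain_member_carrier by blast
    have "c \<in> char_ker G \<chi>" if \<chi>: "\<chi> \<in> Irr G" for \<chi>
    proof -
      obtain i where i: "i \<le> n" "X i = char_center G \<chi>" using \<chi> by (rule center_chain_member)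
      thus ?thesis using c g chain_antimono[of i n] Irr_center_iff[OF \<chi>] by blast
    qed
    thus "c \<in> {\<one>}"
      using Irr_separates_from_normal[OF one_is_normal, of c] c commutators_with_carrier[OF gc] by blast
  qed
  hence "commutator_subgroup G (carrier G) (X n) \<subseteq> {\<one>}"
    by (intro commutator_subgroup_least triv_subgroup)
  thus ?thesis
    unfolding commutator_subgroup_def using generate.one by blast
qed

text \<open>Here nestedness enters. If \<open>[G, h] \<subseteq> [G, g]\<close> failed for some \<open>h \<in> X\<^sub>j\<close>, some \<open>\<psi>\<close> would have
  \<open>[G, g]\<close> but not \<open>[G, h]\<close> in its kernel. Then \<open>Z(\<psi>)\<close> is a member of the chain that contains
  \<open>g \<notin> X\<^bsub>j+1\<^esub>\<close>, so it contains \<open>X\<^sub>j\<close> and with it \<open>h\<close>, a contradiction. The GVZ property turns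
  \<open>[G, g]\<close> into a set of commutators.\<close>

lemma commutator_subgroup_subset_commutators_with:
  assumes j: "Suc j \<le> n" and g: "g \<in> carrier G" "g \<notin> X (Suc j)"
  shows "commutator_subgroup G (carrier G) (X j) \<subseteq> commutators_with G g"
proof -
  let ?D = "commutator_subgroup G (carrier G) {g}"
  have D: "?D \<lhd> G" using g by (intro commutator_subgroup_normal) simp
  have "commutators_with G h \<subseteq> ?D" if h: "h \<in> X j" for h
  proof
    fix c assume c: "c \<in> commutators_with G h"
    have hc: "h \<in> carrier G" using h j chain_member_carrier[of j] by auto
    show "c \<in> ?D"
    proof (rule ccontr)
      assume "c \<notin> ?D"
      then obtain \<psi> where \<psi>: "\<psi> \<in> Irr G" "?D \<subseteq> char_ker G \<psi>" "c \<notin> char_ker G \<psi>"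
        using Irr_separates_from_normal[OF D] c commutators_with_carrier[OF hc] by blast
      obtain k where k: "k \<le> n" "X k = char_center G \<psi>" using \<psi>(1) by (rule center_chain_member)
      have "g \<in> X k"
        using Irr_center_iff[OF \<psi>(1)] k \<psi>(2) g commutators_with_subset_commutator_subgroup[of g "{g}"] by auto
      hence "k \<le> j" using chain_antimono[of "Suc j" k] k g by (metis not_less_eq_eq subsetD)
      hence "h \<in> X k" using chain_antimono[of k j] j h by auto
      thus False using Irr_center_iff[OF \<psi>(1)] k c \<psi>(3) by auto
    qed
  qed
  hence "commutator_subgroup G (carrier G) (X j) \<subseteq> ?D"
    using D by (intro commutator_subgroup_least normal_imp_subgroup)
  thus ?thesis using GVZ g unfolding GVZ_iff by blast
qed

lemma upsilon_eq_commutator_subgroup: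
  "i \<le> n \<Longrightarrow> upsilon G i = commutator_subgroup G (carrier G) (X (n - i))"
proof (induction i)
  case 0
  show ?case using commutator_subgroup_last by simp
next
  case (Suc i)
  define j where "j = n - Suc i"
  have j: "Suc j \<le> n" "n - i = Suc j" using Suc.prems by (auto simp: j_def)
  have K: "upsilon G i = commutator_subgroup G (carrier G) (X (Suc j))" using Suc j by simp
  interpret finite_group_normal G "upsilon G i" by (rule finite_group_normal_upsilon)
  have not_in: "\<not> commutators_with G g \<subseteq> upsilon G i \<longleftrightarrow> g \<notin> X (Suc j)" if "g \<in> carrier G" for g
    using chain_member_iff[OF j(1) that] K by simp
  have Cj: "commutator_subgroup G (carrier G) (X j) \<lhd> G"
    using j by (intro commutator_subgroup_normal chain_member_carrier) simp
  have "commutator_subgroup G (carrier G) (X j) \<subseteq> U_preimage (upsilon G i)"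
    using commutator_subgroup_subset_commutators_with[OF j(1)] not_in
    by (intro subset_U_preimageI Cj) blast
  moreover have "U_preimage (upsilon G i) \<subseteq> commutator_subgroup G (carrier G) (X j)"
  proof
    fix u assume u: "u \<in> U_preimage (upsilon G i)"
    have "X (Suc j) \<subset> X j" using chain j unfolding chain_of_centers_def by simp
    then obtain g where g: "g \<in> X j" "g \<notin> X (Suc j)" by blast
    hence gc: "g \<in> carrier G" using chain_member_carrier[of j] j by auto
    obtain l c where lc: "l \<in> upsilon G i" "c \<in> commutators_with G g" "u = l \<otimes> c"
      using U_preimage_commutator[OF gc _ u] not_in[OF gc] g by blast
    have "upsilon G i \<subseteq> commutator_subgroup G (carrier G) (X j)"
      unfolding K using chain_antimono[of j "Suc j"] j
      by (intro commutator_subgroup_least normal_imp_subgroup[OF Cj] commutators_with_subset_commutator_subgroup) auto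
    moreover have "c \<in> commutator_subgroup G (carrier G) (X j)"
      using lc commutators_with_subset_commutator_subgroup[OF g(1)] by blast
    ultimately show "u \<in> commutator_subgroup G (carrier G) (X j)"
      using lc subgroup.m_closed[OF normal_imp_subgroup[OF Cj]] by blast
  qed
  ultimately show ?case unfolding upsilon_Suc_U_preimage j_def by blast
qed

lemma upsilon_top: "upsilon G (Suc n) = carrier G"
proof -
  interpret finite_group_normal G "upsilon G n" by (rule finite_group_normal_upsilon)
  have "X 0 = carrier G" using chain by (simp add: chain_of_centers_def)
  hence K: "upsilon G n = commutator_subgroup G (carrier G) (carrier G)"
    using upsilon_eq_commutator_subgroup[of n] by simp
  have "carrier G \<subseteq> U_preimage (upsilon G n)"
    using commutators_with_subset_commutator_subgroup[of _ "carrier G"] unfolding K[symmetric]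
    by (intro subset_U_preimageI normal_self) blast
  thus ?thesis unfolding upsilon_Suc_U_preimage by (auto simp: U_preimage_def)
qed

text \<open>As \<open>G\<close> is not abelian, the chain has a member just above \<open>X\<^sub>n\<close>, and its commutator subgroup with
  \<open>G\<close> is nontrivial. That subgroup lies in \<open>X\<^sub>n\<close>: for an element \<open>d\<close> outside, it would be contained
  in the set of commutators \<open>[x, d]\<close>, and \<open>d\<^sup>-\<^sup>1\<close> is not one of these unless \<open>d = 1\<close>.\<close>

lemma last_center_nontrivial:
  assumes nonab: "\<not> comm_group G"
  shows "{\<one>} \<subset> X n"
proof -
  have one: "\<one> \<in> X n"
    using chain_member_center[of n] char_center_subgroup subgroup.one_closed by (metis order_refl)
  have triv: "g \<in> X n \<longleftrightarrow> commutators_with G g \<subseteq> {\<one>}" if "g \<in> carrier G" for g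
    using chain_member_iff[of n, OF _ that] commutator_subgroup_last by simp
  have "n \<noteq> 0"
  proof
    assume "n = 0"
    hence all: "commutators_with G g \<subseteq> {\<one>}" if "g \<in> carrier G" for g
      using chain triv[OF that] that by (simp add: chain_of_centers_def)
    have "x \<otimes> g = g \<otimes> x" if "x \<in> carrier G" "g \<in> carrier G" for x g
    proof -
      have "x \<otimes> g \<otimes> inv x \<otimes> inv g = \<one>" using all[OF that(2)] that(1) by (auto simp: commutators_with_def)
      hence "x \<otimes> g \<otimes> inv (g \<otimes> x) = \<one>" using that by (simp add: m_assoc inv_mult_group)
      thus ?thesis using that by (metis inv_closed inv_equality inv_inv m_closed)
    qed
    hence "comm_group G" by (rule group_comm_groupI)
    thus False using nonab by simp
  qed
  then obtain j where j: "n = Suc j" by (cases n) auto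
  let ?D = "commutator_subgroup G (carrier G) (X j)"
  have D: "subgroup ?D G"
    using j by (intro normal_imp_subgroup commutator_subgroup_normal chain_member_carrier) simp
  have "X n \<subset> X j" using chain j unfolding chain_of_centers_def by simp
  then obtain g where g: "g \<in> X j" "g \<notin> X n" by blast
  have gc: "g \<in> carrier G" using g(1) chain_member_carrier[of j] j by auto
  obtain d where d: "d \<in> ?D" "d \<noteq> \<one>"
    using g triv[OF gc] commutators_with_subset_commutator_subgroup[OF g(1)] by blast
  have dc: "d \<in> carrier G" using d D subgroup.subset by blast
  have "d \<in> X n"
  proof (rule ccontr)
    assume "d \<notin> X n"
    hence "?D \<subseteq> commutators_with G d"
      using commutator_subgroup_subset_commutators_with[of j d] j dc by simp
    moreover have "inv d \<in> ?D" using subgroup.m_inv_closed[OF D d(1)] .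
    ultimately obtain x where x: "x \<in> carrier G" "inv d = x \<otimes> d \<otimes> inv x \<otimes> inv d"
      by (auto simp: commutators_with_def)
    hence "x \<otimes> d \<otimes> inv x = \<one>" using dc r_cancel_one'[of "inv d" "x \<otimes> d \<otimes> inv x"] by simp
    hence "inv x \<otimes> (x \<otimes> d \<otimes> inv x) \<otimes> x = \<one>" using x by simp
    thus False using d(2) dc x by (simp add: m_assoc mult_inv_cancel_left)
  qed
  thus ?thesis using one d(2) by blast
qed

end

end

theorem theorem3:
  fixes G :: "('a, 'b) monoid_scheme" and p :: nat
  assumes "prime p"
    and "group G" and "finite (carrier G)" and "\<not> comm_group G"
    and "\<exists>k. Coset.order G = p ^ k"
  shows "(upsilon_inf G = carrier G \<longleftrightarrow> nested_group G \<and> GVZ_group G) \<and>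
    (nested_group G \<and> GVZ_group G \<longrightarrow>
      (\<forall>n X. chain_of_centers G n X \<longrightarrow>
         {\<one>\<^bsub>G\<^esub>} \<subset> X n \<and>
         (\<forall>i\<le>n. upsilon G i = commutator_subgroup G (carrier G) (X (n - i))) \<and>
         upsilon G (n + 1) = carrier G))"
proof -
  interpret finite_group G
    using assms by (intro finite_group.intro finite_group_axioms.intro)
  have top: "\<exists>m. upsilon G m = carrier G" if "nested_group G" "GVZ_group G"
    using chain_of_centers_exists[OF that(1)] upsilon_top[OF that(2)] by blast
  show ?thesis
  proof (intro conjI impI allI)
    show "upsilon_inf G = carrier G \<longleftrightarrow> nested_group G \<and> GVZ_group G"
      unfolding upsilon_inf_eq_carrier_iff using top upsilon_top_imp_nested_GVZ by blast
  next
    fix n X assume "nested_group G \<and> GVZ_group G" and chain: "chain_of_centers G n X"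
    hence GVZ: "GVZ_group G" by simp
    show "{\<one>\<^bsub>G\<^esub>} \<subset> X n" using assms(4) by (rule last_center_nontrivial[OF GVZ chain])
    show "upsilon G (n + 1) = carrier G" using upsilon_top[OF GVZ chain] by simp
    fix i assume "i \<le> n"
    thus "upsilon G i = commutator_subgroup G (carrier G) (X (n - i))"
      by (rule upsilon_eq_commutator_subgroup[OF GVZ chain])
  qed
qed

end
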